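(* In the linear oblivious setting described in the context, suppose $[T]$ is partitioned into $m$ disjoint nonempty sets $I_1,\dots,I_m$ with $|I_u|=T_u$ such that $\{x_t: t\in I_u\}$ lies in a linear subspace of $\mathbb{R}^d$ of dimension $d_u$. Run QuFUR$(\alpha)$ with inputs $d,T,C,\eta,\alpha$. Then with probability at least $1-\delta$: 1. its query complexity satisfies $Q=\tilde O\big(\sum_{u=1}^m \min\{T_u,\ \tilde\eta\sqrt{\alpha d_u T_u}\}+1\big)$; 2. its regret satisfies $R=\tilde O\big(\sum_{u=1}^m \max\{\tilde\eta^2 d_u,\ \tilde\eta\sqrt{d_uT_u/\alpha}\}\big)$.
   Context: Linear oblivious setting: fix integers $d,T\ge 1$, reals $C>0$, $\eta\ge 0$, $\delta\in(0,1)$, and let $\tilde\eta=\max\{1,\eta\}$. An unknown $\theta^*\in\mathbb{R}^d$ with $\|\theta^*\|_2\le C$ and a sequence $x_1,\dots,x_T\in\mathbb{R}^d$ with $\|x_t\|_2\le 1$ and $|\langle\theta^*,x_t\rangle|\le 1$ are fixed before the interaction (oblivious adversary). Labels are $y_t=\langle\theta^*,x_t\rangle+\xi_t$, where the $\xi_t$ are independent zero-mean sub-Gaussian random variables with variance proxy $\eta^2$, independent of the learner's internal randomness. At each round $t=1,\dots,T$ the learner sees $x_t$, predicts $\hat y_t\in[-1,1]$, then chooses $q_t\in\{0,1\}$; if $q_t=1$ it observes $y_t$. Query complexity: $Q=\sum_{t=1}^T q_t$. Regret: $R=\sum_{t=1}^T(\hat y_t-\langle\theta^*,x_t\rangle)^2$.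 Notation: $\mathrm{clip}(z)=\min(1,\max(-1,z))$; $\|v\|_M=\sqrt{v^\top M v}$. $\tilde O(\cdot)$ hides absolute constants and factors polylogarithmic in $T$, $1/\delta$ and $C$. Algorithm QuFUR$(\alpha)$ (parameter $\alpha>0$): initialize $M\leftarrow C^{-2}I_d$ and queried set $\mathcal{Q}\leftarrow\emptyset$. For each $t$: let $M_t$ be the current $M$; set $\hat\theta_t=M_t^{-1}\sum_{s\in\mathcal{Q}}x_s y_s$; predict $\hat y_t=\mathrm{clip}(\langle\hat\theta_t,x_t\rangle)$; set $\Delta_t=\tilde\eta^2\min\{1,\|x_t\|^2_{M_t^{-1}}\}$; independently set $q_t=1$ with probability $\min\{1,\alpha\Delta_t\}$ and $q_t=0$ otherwise; if $q_t=1$, observe $y_t$, update $M\leftarrow M+x_tx_t^\top$ and $\mathcal{Q}\leftarrow\mathcal{Q}\cup\{t\}$. *)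

theory Defs
  imports "HOL-Probability.Probability"
begin

text \<open>Vectors of R^d are represented as functions nat => real, of which only the
coordinates 0..d-1 are used; d x d matrices as nat => nat => real (entries i,j < d used).\<close>

definition etat :: "real \<Rightarrow> real" where
  "etat eta = max 1 eta"

definition ip :: "nat \<Rightarrow> (nat \<Rightarrow> real) \<Rightarrow> (nat \<Rightarrow> real) \<Rightarrow> real" where
  "ip d u v = (\<Sum>i<d. u i * v i)"

definition clip :: "real \<Rightarrow> real" where
  "clip z = min 1 (max (-1) z)"

definition Mmat :: "real \<Rightarrow> (nat \<Rightarrow> nat \<Rightarrow> real) \<Rightarrow> nat set \<Rightarrow> nat \<Rightarrow> nat \<Rightarrow> real" where
  "Mmat C x S = (\<lambda>i j. (if i = j then 1 / C^2 else 0) + (\<Sum>s\<in>S. x s i * x s j))"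

definition mv :: "nat \<Rightarrow> (nat \<Rightarrow> nat \<Rightarrow> real) \<Rightarrow> (nat \<Rightarrow> real) \<Rightarrow> nat \<Rightarrow> real" where
  "mv d A v = (\<lambda>i. \<Sum>j<d. A i j * v j)"

text \<open>A^(-1) b: the unique solution v in R^d of A v = b (A is positive definite here).\<close>
definition msolve :: "nat \<Rightarrow> (nat \<Rightarrow> nat \<Rightarrow> real) \<Rightarrow> (nat \<Rightarrow> real) \<Rightarrow> nat \<Rightarrow> real" where
  "msolve d A b = (THE v. (\<forall>i<d. mv d A v i = b i) \<and> (\<forall>i. d \<le> i \<longrightarrow> v i = 0))"

definition delta :: "nat \<Rightarrow> real \<Rightarrow> real \<Rightarrow> (nat \<Rightarrow> nat \<Rightarrow> real) \<Rightarrow> nat set \<Rightarrow> nat \<Rightarrow> real" where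
  "delta d C eta x S t = (etat eta)^2 * min 1 (ip d (x t) (msolve d (Mmat C x S) (x t)))"

text \<open>Set of rounds among 1..t queried by QuFUR(alpha); U t in [0,1] is the learner's
  uniform coin for round t, and q_t = 1 iff U t < min 1 (alpha * Delta_t).\<close>
fun qset :: "nat \<Rightarrow> real \<Rightarrow> real \<Rightarrow> real \<Rightarrow> (nat \<Rightarrow> nat \<Rightarrow> real) \<Rightarrow> (nat \<Rightarrow> real) \<Rightarrow> nat \<Rightarrow> nat set" where
  "qset d C eta alpha x U 0 = {}"
| "qset d C eta alpha x U (Suc t) =
     (let S = qset d C eta alpha x U t
      in if U (Suc t) < min 1 (alpha * delta d C eta x S (Suc t)) then insert (Suc t) S else S)"

definition yhat :: "nat \<Rightarrow> real \<Rightarrow> real \<Rightarrow> real \<Rightarrow> (nat \<Rightarrow> nat \<Rightarrow> real) \<Rightarrow> (nat \<Rightarrow> real) \<Rightarrow> (nat \<Rightarrow> real) \<Rightarrow> nat \<Rightarrow> real" where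
  "yhat d C eta alpha x U y t =
     (let S = qset d C eta alpha x U (t - 1);
          th = msolve d (Mmat C x S) (\<lambda>i. \<Sum>s\<in>S. x s i * y s)
      in clip (ip d th (x t)))"

definition query_complexity :: "nat \<Rightarrow> real \<Rightarrow> real \<Rightarrow> real \<Rightarrow> (nat \<Rightarrow> nat \<Rightarrow> real) \<Rightarrow> (nat \<Rightarrow> real) \<Rightarrow> nat \<Rightarrow> nat" where
  "query_complexity d C eta alpha x U T = card (qset d C eta alpha x U T)"

definition regret :: "nat \<Rightarrow> real \<Rightarrow> real \<Rightarrow> real \<Rightarrow> (nat \<Rightarrow> nat \<Rightarrow> real) \<Rightarrow> (nat \<Rightarrow> real) \<Rightarrow> (nat \<Rightarrow> real) \<Rightarrow> (nat \<Rightarrow> real) \<Rightarrow> nat \<Rightarrow> real" where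
  "regret d C eta alpha x U y theta T =
     (\<Sum>t=1..T. (yhat d C eta alpha x U y t - ip d theta (x t))^2)"

definition in_subspace_dim :: "nat \<Rightarrow> nat \<Rightarrow> (nat \<Rightarrow> real) set \<Rightarrow> bool" where
  "in_subspace_dim d k V =
     (\<exists>B :: nat \<Rightarrow> nat \<Rightarrow> real.
        (\<forall>c :: nat \<Rightarrow> real. (\<forall>i<d. (\<Sum>j<k. c j * B j i) = 0) \<longrightarrow> (\<forall>j<k. c j = 0)) \<and>
        (\<forall>v\<in>V. \<exists>c :: nat \<Rightarrow> real. \<forall>i<d. v i = (\<Sum>j<k. c j * B j i)))"

text \<open>Canonical sample space: omega = (noise sequence xi, learner coin sequence U).
  Noise: independent zero-mean sub-Gaussian with variance proxy eta^2; coins: i.i.d.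
  uniform on [0,1]; all mutually independent (rounds 1..T).\<close>
type_synonym omega = "(nat \<Rightarrow> real) \<times> (nat \<Rightarrow> real)"

definition noise_model :: "omega measure \<Rightarrow> real \<Rightarrow> nat \<Rightarrow> bool" where
  "noise_model M eta T =
     (prob_space M \<and>
      prob_space.indep_vars M (\<lambda>_. borel)
        (\<lambda>i. case i of Inl t \<Rightarrow> (\<lambda>\<omega>. fst \<omega> t) | Inr t \<Rightarrow> (\<lambda>\<omega>. snd \<omega> t))
        (Inl ` {1..T} \<union> Inr ` {1..T}) \<and>
      (\<forall>t\<in>{1..T}.
         (\<lambda>\<omega>. fst \<omega> t) \<in> borel_measurable M \<and>
         integrable M (\<lambda>\<omega>. fst \<omega> t) \<and>
         prob_space.expectation M (\<lambda>\<omega>. fst \<omega> t) = 0 \<and>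
         (\<forall>l::real. integrable M (\<lambda>\<omega>. exp (l * fst \<omega> t)) \<and>
            prob_space.expectation M (\<lambda>\<omega>. exp (l * fst \<omega> t)) \<le> exp (l^2 * eta^2 / 2)) \<and>
         (\<lambda>\<omega>. snd \<omega> t) \<in> borel_measurable M \<and>
         distr M borel (\<lambda>\<omega>. snd \<omega> t) = uniform_measure lborel {0..1}))"

end

theory Submission
  imports Defs "Jordan_Normal_Form.Determinant"
begin

text \<open>
The queried set depends only on the coins and the fixed design, never on the noise. Given the
queried set, the estimation error in direction \<open>x\<^sub>t\<close> is therefore a bias of size at most
\<open>\<parallel>x\<^sub>t\<parallel>\<close> in the norm of \<open>M\<^sub>t\<^sup>-\<^sup>1\<close> plus a fixed linear combination of the noise variables whose
variance proxy is at most \<open>\<eta>\<^sup>2 \<parallel>x\<^sub>t\<parallel>\<^sup>2\<close>; hence the squared error is at most \<open>\<Delta>\<^sub>t\<close> up to logarithms,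
without a factor \<open>d\<close>. With \<open>p\<^sub>t = min 1 (\<alpha> \<Delta>\<^sub>t)\<close>, the sum of \<open>p\<^sub>t \<Delta>\<^sub>t\<close> over \<open>I\<^sub>u\<close> is comparable to
the sum of \<open>q\<^sub>t \<Delta>\<^sub>t\<close>, which the elliptic potential inside the \<open>d\<^sub>u\<close>-dimensional subspace bounds by
\<open>(max 1 \<eta>)\<^sup>2 d\<^sub>u\<close> up to logarithms. Since \<open>p\<^sub>t\<^sup>2 \<le> \<alpha> p\<^sub>t \<Delta>\<^sub>t\<close> and
\<open>\<Delta>\<^sub>t \<le> p\<^sub>t \<Delta>\<^sub>t + \<surd>(p\<^sub>t \<Delta>\<^sub>t / \<alpha>)\<close>, Cauchy-Schwarz gives both claims.
\<close>

unbundle no vec_syntax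

section \<open>Positive definite matrices and their inverse quadratic forms\<close>

lemma ip_commute: "ip d u v = ip d v u"
  by (simp add: ip_def mult.commute)

lemma ip_cong: "(\<And>i. i < d \<Longrightarrow> u i = u' i) \<Longrightarrow> (\<And>i. i < d \<Longrightarrow> v i = v' i) \<Longrightarrow> ip d u v = ip d u' v'"
  by (simp add: ip_def)

lemma ip_diff_right: "ip d w (\<lambda>i. u i - v i) = ip d w u - ip d w v"
  by (simp add: ip_def right_diff_distrib sum_subtractf)

lemma ip_scale_right: "ip d w (\<lambda>i. k * u i) = k * ip d w u"
  by (simp add: ip_def sum_distrib_left mult.left_commute)

lemma ip_scale_left: "ip d (\<lambda>i. k * u i) w = k * ip d u w"
  by (simp add: ip_def sum_distrib_left mult.assoc)

lemma ip_sum_left: "ip d (\<lambda>i. \<Sum>s\<in>S. f s i) w = (\<Sum>s\<in>S. ip d (f s) w)"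
  by (simp add: ip_def sum_distrib_right) (rule sum.swap)

lemma ip_self_nonneg: "0 \<le> ip d v v"
  by (simp add: ip_def sum_nonneg)

lemma ip_self_eq_0_iff: "ip d v v = 0 \<longleftrightarrow> (\<forall>i<d. v i = 0)"
  by (auto simp: ip_def sum_nonneg_eq_0_iff)

lemma ip_Cauchy_Schwarz: "(ip d u v)\<^sup>2 \<le> ip d u u * ip d v v"
  using Cauchy_Schwarz_ineq_sum[of u v "{..<d}"] by (simp add: ip_def power2_eq_square)

lemma mv_diff: "mv d N (\<lambda>i. v i - w i) i = mv d N v i - mv d N w i"
  by (simp add: mv_def right_diff_distrib sum_subtractf)

lemma mv_scale: "mv d N (\<lambda>i. k * v i) i = k * mv d N v i"
  by (simp add: mv_def sum_distrib_left mult.left_commute)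

definition pos_def :: "nat \<Rightarrow> (nat \<Rightarrow> nat \<Rightarrow> real) \<Rightarrow> bool" where
  "pos_def d N \<longleftrightarrow> (\<forall>i<d. \<forall>j<d. N i j = N j i) \<and> (\<forall>v. (\<exists>i<d. v i \<noteq> 0) \<longrightarrow> 0 < ip d v (mv d N v))"

lemma pos_def_symmetric:
  assumes "pos_def d N"
  shows "ip d u (mv d N v) = ip d v (mv d N u)"
proof -
  have "ip d u (mv d N v) = (\<Sum>j<d. \<Sum>i<d. u i * (N i j * v j))"
    unfolding ip_def mv_def sum_distrib_left by (rule sum.swap)
  also have "\<dots> = (\<Sum>j<d. \<Sum>i<d. v j * (N j i * u i))"
    using assms by (intro sum.cong) (auto simp: pos_def_def)
  finally show ?thesis
    by (simp add: ip_def mv_def sum_distrib_left)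
qed

lemma pos_def_nonneg:
  assumes "pos_def d N"
  shows "0 \<le> ip d v (mv d N v)"
proof (cases "\<exists>i<d. v i \<noteq> 0")
  case True
  then show ?thesis using assms by (auto simp: pos_def_def less_imp_le)
qed (simp add: ip_def)

lemma pos_def_kernel:
  assumes "pos_def d N" "\<And>i. i < d \<Longrightarrow> mv d N v i = 0" "i < d"
  shows "v i = 0"
proof (rule ccontr)
  assume "v i \<noteq> 0"
  then have "0 < ip d v (mv d N v)"
    using assms(1,3) by (auto simp: pos_def_def)
  then show False
    using assms(2) by (simp add: ip_def)
qed

lemma pos_def_solvable:
  assumes "pos_def d N"
  obtains v where "\<And>i. i < d \<Longrightarrow> mv d N v i = b i" "\<And>i. d \<le> i \<Longrightarrow> v i = 0"
proof -
  define A where "A = Matrix.mat d d (\<lambda>(i, j). N i j)"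
  have carrier_A [simp]: "A \<in> carrier_mat d d" by (simp add: A_def)
  have mult_A: "(A *\<^sub>v w) $ i = mv d N (($) w) i" if "w \<in> carrier_vec d" "i < d" for w i
    using that by (simp add: A_def scalar_prod_def mv_def atLeast0LessThan)
  have "w = 0\<^sub>v d" if kernel_w: "w \<in> carrier_vec d" "A *\<^sub>v w = 0\<^sub>v d" for w
  proof
    fix i assume "i < dim_vec (0\<^sub>v d :: real Matrix.vec)"
    moreover have "mv d N (($) w) j = 0" if "j < d" for j
      using mult_A[OF kernel_w(1) that] kernel_w(2) that by simp
    ultimately show "w $ i = 0\<^sub>v d $ i"
      using pos_def_kernel[OF assms] by simp
  qed (use kernel_w in simp)
  then have "det A \<noteq> 0"
    using det_0_iff_vec_prod_zero_field[OF carrier_A] by blast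
  then obtain B where inverse_B: "B \<in> carrier_mat d d" "A * B = 1\<^sub>m d"
    using det_non_zero_imp_unit[OF carrier_A, of "()"] by (auto simp: Units_def ring_mat_def)
  define w where "w = B *\<^sub>v Matrix.vec d b"
  have carrier_w: "w \<in> carrier_vec d" using inverse_B(1) by (simp add: w_def)
  have "A *\<^sub>v w = (A * B) *\<^sub>v Matrix.vec d b"
    unfolding w_def by (rule assoc_mult_mat_vec[symmetric, OF carrier_A inverse_B(1)]) simp
  then have A_w_eq: "A *\<^sub>v w = Matrix.vec d b" using inverse_B(2) by simp
  show thesis
  proof (rule that)
    show "mv d N (\<lambda>i. if i < d then w $ i else 0) i = b i" if "i < d" for i
      using mult_A[OF carrier_w that] A_w_eq that by (simp add: mv_def)
  qed simp
qed

lemma msolve_eqI: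
  assumes "pos_def d N" "\<And>i. i < d \<Longrightarrow> mv d N v i = b i" "\<And>i. d \<le> i \<Longrightarrow> v i = 0"
  shows "msolve d N b = v"
  unfolding msolve_def
proof (rule the_equality)
  fix w assume solution_w: "(\<forall>i<d. mv d N w i = b i) \<and> (\<forall>i. d \<le> i \<longrightarrow> w i = 0)"
  show "w = v"
  proof
    fix i
    have "w i - v i = 0" if "i < d"
      using pos_def_kernel[OF assms(1) _ that, of "\<lambda>i. w i - v i"] assms(2) solution_w by (simp add: mv_diff)
    then show "w i = v i"
      using solution_w assms(3) by (cases "i < d") simp_all
  qed
qed (use assms in simp)

lemma msolve_solves:
  assumes "pos_def d N"
  shows "i < d \<Longrightarrow> mv d N (msolve d N b) i = b i" and "d \<le> i \<Longrightarrow> msolve d N b i = 0"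
proof -
  obtain v where "\<And>i. i < d \<Longrightarrow> mv d N v i = b i" "\<And>i. d \<le> i \<Longrightarrow> v i = 0"
    using pos_def_solvable[OF assms] by blast
  with msolve_eqI[OF assms this]
  show "i < d \<Longrightarrow> mv d N (msolve d N b) i = b i" and "d \<le> i \<Longrightarrow> msolve d N b i = 0"
    by auto
qed

lemma ip_mv_msolve:
  assumes "pos_def d N"
  shows "ip d u (mv d N (msolve d N b)) = ip d u b"
  using msolve_solves(1)[OF assms] by (intro ip_cong) auto

definition inv_ip :: "nat \<Rightarrow> (nat \<Rightarrow> nat \<Rightarrow> real) \<Rightarrow> (nat \<Rightarrow> real) \<Rightarrow> (nat \<Rightarrow> real) \<Rightarrow> real" where
  "inv_ip d N a b = ip d a (msolve d N b)"

lemma inv_ip_commute: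
  assumes "pos_def d N"
  shows "inv_ip d N a b = inv_ip d N b a"
  using pos_def_symmetric[OF assms, of "msolve d N a" "msolve d N b"]
  by (simp add: inv_ip_def ip_mv_msolve[OF assms] ip_commute[of d "msolve d N _"])

lemma inv_ip_self:
  assumes "pos_def d N"
  shows "inv_ip d N a a = ip d (msolve d N a) (mv d N (msolve d N a))"
  by (simp add: inv_ip_def ip_mv_msolve[OF assms] ip_commute)

lemma inv_ip_nonneg: "pos_def d N \<Longrightarrow> 0 \<le> inv_ip d N a a"
  by (simp add: inv_ip_self pos_def_nonneg)

lemma inv_ip_leI:
  assumes "pos_def d N" "\<kappa> \<ge> 0" "\<And>v. (ip d a v)\<^sup>2 \<le> \<kappa> * ip d v (mv d N v)"
  shows "inv_ip d N a a \<le> \<kappa>"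
proof -
  have "(inv_ip d N a a)\<^sup>2 \<le> \<kappa> * inv_ip d N a a"
    using assms(3)[of "msolve d N a"] unfolding inv_ip_self[OF assms(1), symmetric]
    by (simp add: inv_ip_def)
  then show ?thesis
    using inv_ip_nonneg[OF assms(1), of a] assms(2)
    by (cases "inv_ip d N a a = 0") (auto simp: power2_eq_square)
qed

lemma pos_def_Cauchy_Schwarz:
  assumes "pos_def d N"
  shows "(ip d u (mv d N v))\<^sup>2 \<le> ip d u (mv d N u) * ip d v (mv d N v)"
proof (cases "\<exists>i<d. v i \<noteq> 0")
  case True
  define q where "q = ip d v (mv d N v)"
  define k where "k = ip d u (mv d N v) / q"
  have q_pos: "q > 0" using assms True by (auto simp: q_def pos_def_def)
  have mv_u_minus_kv: "mv d N (\<lambda>i. u i - k * v i) = (\<lambda>i. mv d N u i - k * mv d N v i)"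
    by (simp add: fun_eq_iff mv_diff mv_scale)
  have "0 \<le> ip d (\<lambda>i. u i - k * v i) (mv d N (\<lambda>i. u i - k * v i))"
    by (rule pos_def_nonneg[OF assms])
  also have "\<dots> = ip d u (mv d N u) - 2 * k * ip d u (mv d N v) + k\<^sup>2 * q"
    unfolding mv_u_minus_kv ip_diff_right ip_scale_right ip_commute[of d "\<lambda>i. u i - k * v i"]
    by (simp add: q_def ip_commute[of d "mv d N _"] pos_def_symmetric[OF assms, of v u]
        algebra_simps power2_eq_square)
  also have "\<dots> = ip d u (mv d N u) - (ip d u (mv d N v))\<^sup>2 / q"
    using q_pos by (simp add: k_def power2_eq_square field_simps)
  finally show ?thesis
    using q_pos by (simp add: q_def field_simps)
next
  case False
  then have "ip d u (mv d N v) = 0" by (simp add: ip_def mv_def)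
  then show ?thesis by (simp add: mult_nonneg_nonneg pos_def_nonneg[OF assms])
qed

lemma inv_ip_antimono:
  assumes "pos_def d N" "pos_def d N'" "\<And>v. ip d v (mv d N v) \<le> ip d v (mv d N' v)"
  shows "inv_ip d N' a a \<le> inv_ip d N a a"
proof (rule inv_ip_leI[OF assms(2) inv_ip_nonneg[OF assms(1)]])
  fix v
  have "ip d a v = ip d (msolve d N a) (mv d N v)"
    unfolding pos_def_symmetric[OF assms(1)] by (simp add: ip_mv_msolve[OF assms(1)] ip_commute)
  then have "(ip d a v)\<^sup>2 \<le> inv_ip d N a a * ip d v (mv d N v)"
    using pos_def_Cauchy_Schwarz[OF assms(1)] by (simp add: inv_ip_self[OF assms(1)])
  also have "\<dots> \<le> inv_ip d N a a * ip d v (mv d N' v)"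
    by (intro mult_left_mono assms(3) inv_ip_nonneg[OF assms(1)])
  finally show "(ip d a v)\<^sup>2 \<le> inv_ip d N a a * ip d v (mv d N' v)" .
qed

definition scaled_id :: "real \<Rightarrow> nat \<Rightarrow> nat \<Rightarrow> real" where
  "scaled_id c = (\<lambda>i j. if i = j then c else 0)"

lemma mv_scaled_id: "i < d \<Longrightarrow> mv d (scaled_id c) v i = c * v i"
  by (simp add: mv_def scaled_id_def if_distrib[of "\<lambda>x. x * _"] cong: if_cong)

lemma ip_mv_scaled_id: "ip d u (mv d (scaled_id c) v) = c * ip d u v"
  unfolding ip_scale_right[symmetric] by (rule ip_cong) (simp_all add: mv_scaled_id)

lemma pos_def_scaled_id:
  assumes "c > 0"
  shows "pos_def d (scaled_id c)"
  unfolding pos_def_def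
proof (intro conjI allI impI)
  fix v :: "nat \<Rightarrow> real" assume "\<exists>i<d. v i \<noteq> 0"
  then have "ip d v v > 0"
    using ip_self_nonneg[of d v] ip_self_eq_0_iff[of d v] by force
  then show "0 < ip d v (mv d (scaled_id c) v)"
    using assms by (simp add: ip_mv_scaled_id)
qed (simp add: scaled_id_def)

lemma inv_ip_scaled_id:
  assumes "c > 0"
  shows "inv_ip d (scaled_id c) a b = ip d a b / c"
proof -
  have "msolve d (scaled_id c) b = (\<lambda>i. if i < d then b i / c else 0)"
    using assms by (intro msolve_eqI pos_def_scaled_id) (auto simp: mv_scaled_id)
  then show ?thesis
    by (simp add: inv_ip_def ip_def sum_divide_distrib)
qed

definition add_gram :: "(nat \<Rightarrow> nat \<Rightarrow> real) \<Rightarrow> ('a \<Rightarrow> nat \<Rightarrow> real) \<Rightarrow> 'a set \<Rightarrow> nat \<Rightarrow> nat \<Rightarrow> real" where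
  "add_gram N x S = (\<lambda>i j. N i j + (\<Sum>s\<in>S. x s i * x s j))"

definition rank1_update :: "(nat \<Rightarrow> nat \<Rightarrow> real) \<Rightarrow> (nat \<Rightarrow> real) \<Rightarrow> nat \<Rightarrow> nat \<Rightarrow> real" where
  "rank1_update N a = (\<lambda>i j. N i j + a i * a j)"

lemma add_gram_empty [simp]: "add_gram N x {} = N"
  by (simp add: add_gram_def)

lemma add_gram_insert:
  "finite S \<Longrightarrow> t \<notin> S \<Longrightarrow> add_gram N x (insert t S) = rank1_update (add_gram N x S) (x t)"
  by (simp add: add_gram_def rank1_update_def fun_eq_iff)

lemma add_gram_rank1_update: "add_gram (rank1_update N a) x S = rank1_update (add_gram N x S) a"
  by (simp add: add_gram_def rank1_update_def fun_eq_iff)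

lemma rank1_update_commute: "rank1_update (rank1_update N a) b = rank1_update (rank1_update N b) a"
  by (simp add: rank1_update_def fun_eq_iff)

lemma mv_rank1_update: "mv d (rank1_update N a) v i = mv d N v i + ip d a v * a i"
  by (simp add: mv_def rank1_update_def ip_def algebra_simps sum.distrib sum_distrib_left)

lemma ip_mv_rank1_update:
  "ip d u (mv d (rank1_update N a) v) = ip d u (mv d N v) + ip d a u * ip d a v"
proof -
  have "ip d u (mv d (rank1_update N a) v) = ip d u (mv d N v) + ip d u (\<lambda>i. ip d a v * a i)"
    by (simp add: ip_def mv_rank1_update distrib_left sum.distrib)
  then show ?thesis
    by (simp add: ip_scale_right ip_commute[of d u a])
qed

lemma ip_mv_add_gram:
  assumes "finite S"
  shows "ip d u (mv d (add_gram N x S) v) = ip d u (mv d N v) + (\<Sum>s\<in>S. ip d (x s) u * ip d (x s) v)"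
  using assms by induction (simp_all add: add_gram_insert ip_mv_rank1_update)

lemma pos_def_rank1_update: "pos_def d N \<Longrightarrow> pos_def d (rank1_update N a)"
  unfolding pos_def_def ip_mv_rank1_update
  by (auto simp: rank1_update_def mult.commute intro!: add_pos_nonneg)

lemma pos_def_add_gram:
  assumes "pos_def d N" "finite S"
  shows "pos_def d (add_gram N x S)"
  using assms(2) by induction (simp_all add: assms(1) add_gram_insert pos_def_rank1_update)

lemma inv_ip_add_gram_antimono:
  assumes "pos_def d N" "finite S'" "S \<subseteq> S'"
  shows "inv_ip d (add_gram N x S') a a \<le> inv_ip d (add_gram N x S) a a"
proof (rule inv_ip_antimono)
  have "finite S" using assms finite_subset by blast
  then show "pos_def d (add_gram N x S)" "pos_def d (add_gram N x S')"
    using assms by (simp_all add: pos_def_add_gram)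
  show "ip d v (mv d (add_gram N x S) v) \<le> ip d v (mv d (add_gram N x S') v)" for v
    using assms \<open>finite S\<close> by (simp add: ip_mv_add_gram sum_mono2)
qed

lemma msolve_rank1_update:
  assumes "pos_def d N"
  shows "msolve d (rank1_update N a) b =
    (\<lambda>i. msolve d N b i - inv_ip d N a b / (1 + inv_ip d N a a) * msolve d N a i)"
proof -
  define k where "k = inv_ip d N a b / (1 + inv_ip d N a a)"
  have k_eq: "inv_ip d N a b = k * (1 + inv_ip d N a a)"
    using inv_ip_nonneg[OF assms, of a] by (simp add: k_def)
  have "msolve d (rank1_update N a) b = (\<lambda>i. msolve d N b i - k * msolve d N a i)"
  proof (rule msolve_eqI[OF pos_def_rank1_update[OF assms]])
    fix i assume "i < d"
    then show "mv d (rank1_update N a) (\<lambda>i. msolve d N b i - k * msolve d N a i) i = b i"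
      using k_eq by (simp add: mv_rank1_update mv_diff mv_scale ip_diff_right ip_scale_right
          msolve_solves(1)[OF assms] inv_ip_def algebra_simps)
  qed (simp add: msolve_solves(2)[OF assms])
  then show ?thesis by (simp add: k_def)
qed

lemma inv_ip_rank1_update:
  assumes "pos_def d N"
  shows "inv_ip d (rank1_update N a) b b = inv_ip d N b b - (inv_ip d N a b)\<^sup>2 / (1 + inv_ip d N a a)"
  unfolding inv_ip_def[of d "rank1_update N a"] msolve_rank1_update[OF assms] ip_diff_right ip_scale_right
  unfolding inv_ip_def[symmetric]
  by (simp add: power2_eq_square inv_ip_commute[OF assms, of b a])

text \<open>Both sides are the ratio of the determinants of \<open>N + a a\<^sup>T + b b\<^sup>T\<close> and \<open>N\<close>.\<close>
lemma inv_ip_rank1_update_exchange: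
  assumes "pos_def d N"
  shows "(1 + inv_ip d N a a) * (1 + inv_ip d (rank1_update N a) b b) =
         (1 + inv_ip d N b b) * (1 + inv_ip d (rank1_update N b) a a)"
proof -
  have expand: "(1 + A) * (1 + (B - G / (1 + A))) = (1 + A) * (1 + B) - G" if "A \<ge> 0" for A B G :: real
    using that by (simp add: field_simps)
  show ?thesis
    unfolding inv_ip_rank1_update[OF assms] expand[OF inv_ip_nonneg[OF assms]]
    by (simp add: inv_ip_commute[OF assms, of a b] algebra_simps)
qed

section \<open>Elliptic potential of vectors in a subspace\<close>

abbreviation past :: "'a::order set \<Rightarrow> 'a \<Rightarrow> 'a set" where
  "past S t \<equiv> S \<inter> {..<t}"

definition potential ::
  "nat \<Rightarrow> (nat \<Rightarrow> nat \<Rightarrow> real) \<Rightarrow> ('a::linorder \<Rightarrow> nat \<Rightarrow> real) \<Rightarrow> 'a set \<Rightarrow> real" where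
  "potential d N x S = (\<Prod>s\<in>S. 1 + inv_ip d (add_gram N x (past S s)) (x s) (x s))"

lemma potential_nonneg:
  assumes "pos_def d N" "finite S"
  shows "0 \<le> potential d N x S"
  unfolding potential_def using assms
  by (intro prod_nonneg add_nonneg_nonneg ballI inv_ip_nonneg pos_def_add_gram) auto

lemma potential_insert_min:
  assumes "finite S" "\<And>s. s \<in> S \<Longrightarrow> b < s"
  shows "potential d N x (insert b S) = (1 + inv_ip d N (x b) (x b)) * potential d (rank1_update N (x b)) x S"
proof -
  have "b \<notin> S" and past_b: "past (insert b S) b = {}"
    using assms(2) by force+
  have "add_gram N x (past (insert b S) s) = add_gram (rank1_update N (x b)) x (past S s)" if "s \<in> S" for s
  proof -
    have "past (insert b S) s = insert b (past S s)" using assms(2)[OF that] by auto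
    then show ?thesis
      using assms(1) \<open>b \<notin> S\<close> by (simp add: add_gram_insert add_gram_rank1_update)
  qed
  then show ?thesis
    using assms(1) \<open>b \<notin> S\<close> by (simp add: potential_def past_b)
qed

lemma potential_le_rank1_update:
  assumes "pos_def d N" "finite S"
  shows "potential d N x S \<le> (1 + inv_ip d N a a) * potential d (rank1_update N a) x S"
  using assms(2,1)
proof (induction arbitrary: N rule: finite_linorder_min_induct)
  case empty
  then show ?case by (simp add: potential_def inv_ip_nonneg)
next
  case (insert b S)
  let ?Na = "rank1_update N a" and ?Nb = "rank1_update N (x b)"
  have "potential d N x (insert b S) = (1 + inv_ip d N (x b) (x b)) * potential d ?Nb x S"
    using insert.hyps by (simp add: potential_insert_min)
  also have "\<dots> \<le> (1 + inv_ip d N (x b) (x b)) * ((1 + inv_ip d ?Nb a a) * potential d (rank1_update ?Nb a) x S)"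
    using insert.prems
    by (intro mult_left_mono insert.IH pos_def_rank1_update) (simp_all add: inv_ip_nonneg)
  also have "\<dots> = (1 + inv_ip d N a a) * ((1 + inv_ip d ?Na (x b) (x b)) * potential d (rank1_update ?Na (x b)) x S)"
    using inv_ip_rank1_update_exchange[OF insert.prems, of a "x b"]
    by (simp add: rank1_update_commute[of N a] flip: mult.assoc)
  also have "\<dots> = (1 + inv_ip d N a a) * potential d ?Na x (insert b S)"
    using insert.hyps by (simp add: potential_insert_min)
  finally show ?case .
qed

lemma potential_le_add_gram:
  assumes "pos_def d N" "finite S" "finite J" "\<And>j. j \<in> J \<Longrightarrow> inv_ip d N (e j) (e j) \<le> \<beta>" "\<beta> \<ge> 0"
  shows "potential d N x S \<le> (1 + \<beta>) ^ card J * potential d (add_gram N e J) x S"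
  using assms(3,4)
proof (induction J rule: finite_induct)
  case (insert j J)
  let ?N = "add_gram N e J" and ?P = "potential d (add_gram N e (insert j J)) x S"
  have pos_def_N: "pos_def d ?N" using assms(1) insert.hyps by (simp add: pos_def_add_gram)
  have gram_insert: "add_gram N e (insert j J) = rank1_update ?N (e j)"
    using insert.hyps by (simp add: add_gram_insert)
  have "inv_ip d ?N (e j) (e j) \<le> inv_ip d N (e j) (e j)"
    using inv_ip_add_gram_antimono[OF assms(1) insert.hyps(1), of "{}"] by simp
  also have "\<dots> \<le> \<beta>" using insert.prems by simp
  finally have "(1 + inv_ip d ?N (e j) (e j)) * ?P \<le> (1 + \<beta>) * ?P"
    using pos_def_N by (intro mult_right_mono) (simp_all add: gram_insert potential_nonneg pos_def_rank1_update assms(2))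
  moreover have "potential d ?N x S \<le> (1 + inv_ip d ?N (e j) (e j)) * ?P"
    unfolding gram_insert by (rule potential_le_rank1_update[OF pos_def_N assms(2)])
  ultimately have "(1 + \<beta>) ^ card J * potential d ?N x S \<le> (1 + \<beta>) ^ card J * ((1 + \<beta>) * ?P)"
    using assms(5) by (intro mult_left_mono) auto
  moreover have "potential d N x S \<le> (1 + \<beta>) ^ card J * potential d ?N x S"
    using insert by simp
  ultimately show ?case using insert.hyps by (simp add: mult_ac)
qed simp

text \<open>Zero vectors are allowed, so that the orthonormalisation below also accepts linearly dependent
  families.\<close>
definition orthonormal_or_0 :: "nat \<Rightarrow> nat \<Rightarrow> (nat \<Rightarrow> nat \<Rightarrow> real) \<Rightarrow> bool" where
  "orthonormal_or_0 d k e \<longleftrightarrow> (\<forall>j<k. \<forall>l<k. j \<noteq> l \<longrightarrow> ip d (e j) (e l) = 0) \<and> (\<forall>j<k. ip d (e j) (e j) \<in> {0, 1})"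

lemma orthonormal_or_0_ip_self:
  assumes "orthonormal_or_0 d k e" "j < k"
  shows "ip d (e j) a * ip d (e j) (e j) = ip d (e j) a"
proof (cases "ip d (e j) (e j) = 0")
  case True
  then have "\<forall>i<d. e j i = 0" by (simp add: ip_self_eq_0_iff)
  then show ?thesis by (simp add: ip_def)
next
  case False
  then show ?thesis using assms by (auto simp: orthonormal_or_0_def)
qed

lemma orthonormal_or_0_coefficient:
  assumes "orthonormal_or_0 d k e" "l < k"
  shows "ip d (e l) (\<lambda>i. \<Sum>j<k. w j * e j i) = w l * ip d (e l) (e l)"
proof -
  have "ip d (e l) (\<lambda>i. \<Sum>j<k. w j * e j i) = (\<Sum>j<k. w j * ip d (e j) (e l))"
    by (subst ip_commute) (simp add: ip_sum_left ip_scale_left)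
  also have "\<dots> = (\<Sum>j<k. if j = l then w l * ip d (e l) (e l) else 0)"
    using assms by (intro sum.cong) (auto simp: orthonormal_or_0_def)
  finally show ?thesis using assms(2) by simp
qed

lemma orthonormal_or_0_expansion:
  assumes "orthonormal_or_0 d k e" "\<And>i. i < d \<Longrightarrow> a i = (\<Sum>j<k. w j * e j i)" "i < d"
  shows "a i = (\<Sum>j<k. ip d (e j) a * e j i)"
  unfolding assms(2)[OF assms(3)]
proof (intro sum.cong refl)
  fix j assume j_less: "j \<in> {..<k}"
  have "ip d (e j) a = ip d (e j) (\<lambda>i. \<Sum>j<k. w j * e j i)"
    by (rule ip_cong) (simp_all add: assms(2))
  also have "\<dots> = w j * ip d (e j) (e j)"
    using j_less by (simp add: orthonormal_or_0_coefficient[OF assms(1)])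
  finally have coefficient: "ip d (e j) a = w j * ip d (e j) (e j)" .
  have "ip d (e j) (e j) = 1 \<or> e j i = 0"
    using assms(1,3) j_less ip_self_eq_0_iff[of d "e j"] by (auto simp: orthonormal_or_0_def)
  then show "w j * e j i = ip d (e j) a * e j i"
    by (auto simp: coefficient)
qed

lemma orthonormal_or_0_Parseval:
  assumes "orthonormal_or_0 d k e" "\<And>i. i < d \<Longrightarrow> a i = (\<Sum>j<k. w j * e j i)"
  shows "(\<Sum>j<k. (ip d (e j) a)\<^sup>2) = ip d a a"
proof -
  have "ip d a a = ip d (\<lambda>i. \<Sum>j<k. ip d (e j) a * e j i) a"
    by (rule ip_cong) (simp_all flip: orthonormal_or_0_expansion[OF assms])
  then show ?thesis
    by (simp add: ip_sum_left ip_scale_left power2_eq_square)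
qed

lemma Gram_Schmidt_step:
  assumes "orthonormal_or_0 d k e"
  obtains f r where "orthonormal_or_0 d (Suc k) (e(k := f))"
    and "\<And>i. i < d \<Longrightarrow> b i = (\<Sum>j<k. ip d (e j) b * e j i) + r * f i"
proof -
  define g where "g = (\<lambda>i. b i - (\<Sum>j<k. ip d (e j) b * e j i))"
  define r where "r = sqrt (ip d g g)"
  define f where "f = (\<lambda>i. 1 / r * g i)"
  have r_squared: "r * r = ip d g g" using ip_self_nonneg[of d g] by (simp add: r_def)
  have orth_f: "ip d (e l) f = 0" if "l < k" for l
    unfolding f_def g_def ip_scale_right ip_diff_right orthonormal_or_0_coefficient[OF assms that]
      orthonormal_or_0_ip_self[OF assms that] by simp
  have norm_f: "ip d f f \<in> {0, 1}"
    unfolding f_def ip_scale_left ip_scale_right r_squared[symmetric] by simp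
  have "orthonormal_or_0 d (Suc k) (e(k := f))"
    using assms orth_f orth_f[unfolded ip_commute[of d _ f]] norm_f
    by (simp add: orthonormal_or_0_def less_Suc_eq)
  moreover have "b i = (\<Sum>j<k. ip d (e j) b * e j i) + r * f i" if "i < d" for i
  proof -
    have "g i = r * f i"
      using r_squared ip_self_eq_0_iff[of d g] that by (cases "r = 0") (auto simp: f_def)
    then show ?thesis by (simp add: g_def)
  qed
  ultimately show thesis using that by blast
qed

lemma Gram_Schmidt:
  obtains e where "orthonormal_or_0 d k e"
    and "\<And>c. \<exists>w. \<forall>i<d. (\<Sum>j<k. c j * B j i) = (\<Sum>j<k. w j * e j i)"
proof (induction k arbitrary: thesis)
  case 0
  then show ?case by (simp add: orthonormal_or_0_def)
next
  case (Suc k)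
  obtain e where orthonormal_e: "orthonormal_or_0 d k e"
    and span_e: "\<And>c. \<exists>w. \<forall>i<d. (\<Sum>j<k. c j * B j i) = (\<Sum>j<k. w j * e j i)"
    using Suc.IH by blast
  obtain f r where orthonormal_f: "orthonormal_or_0 d (Suc k) (e(k := f))"
    and expansion_B: "\<And>i. i < d \<Longrightarrow> B k i = (\<Sum>j<k. ip d (e j) (B k) * e j i) + r * f i"
    using Gram_Schmidt_step[OF orthonormal_e, of "B k"] by metis
  have "\<exists>w. \<forall>i<d. (\<Sum>j<Suc k. c j * B j i) = (\<Sum>j<Suc k. w j * (e(k := f)) j i)" for c
  proof -
    obtain w where expansion_w: "\<And>i. i < d \<Longrightarrow> (\<Sum>j<k. c j * B j i) = (\<Sum>j<k. w j * e j i)"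
      using span_e by blast
    let ?w = "\<lambda>j. if j = k then c k * r else w j + c k * ip d (e j) (B k)"
    have "(\<Sum>j<Suc k. c j * B j i) = (\<Sum>j<Suc k. ?w j * (e(k := f)) j i)" if "i < d" for i
      by (simp add: expansion_w[OF that] expansion_B[OF that] algebra_simps sum.distrib
          sum_distrib_left cong: sum.cong_simp)
    then show ?thesis by (intro exI[of _ ?w]) simp
  qed
  with orthonormal_f show ?case by (rule Suc.prems)
qed

lemma inv_ip_add_orthonormal_le:
  assumes "pos_def d N" "orthonormal_or_0 d k e" "\<And>i. i < d \<Longrightarrow> a i = (\<Sum>j<k. w j * e j i)" "r \<noteq> 0"
  shows "inv_ip d (add_gram N (\<lambda>j i. r * e j i) {..<k}) a a \<le> ip d a a / r\<^sup>2"
proof (rule inv_ip_leI)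
  let ?N = "add_gram N (\<lambda>j i. r * e j i) {..<k}"
  show "pos_def d ?N" using assms(1) by (simp add: pos_def_add_gram)
  show "0 \<le> ip d a a / r\<^sup>2" by (simp add: ip_self_nonneg)
  fix v
  have "ip d a v = ip d (\<lambda>i. \<Sum>j<k. ip d (e j) a * e j i) v"
    by (rule ip_cong) (simp_all flip: orthonormal_or_0_expansion[OF assms(2,3)])
  also have "\<dots> = (\<Sum>j<k. ip d (e j) a * ip d (e j) v)"
    by (simp add: ip_sum_left ip_scale_left)
  finally have "(ip d a v)\<^sup>2 \<le> (\<Sum>j<k. (ip d (e j) a)\<^sup>2) * (\<Sum>j<k. (ip d (e j) v)\<^sup>2)"
    using Cauchy_Schwarz_ineq_sum[of "\<lambda>j. ip d (e j) a" "\<lambda>j. ip d (e j) v" "{..<k}"] by simp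
  also have "(\<Sum>j<k. (ip d (e j) a)\<^sup>2) = ip d a a"
    by (rule orthonormal_or_0_Parseval[OF assms(2,3)])
  also have "ip d a a * (\<Sum>j<k. (ip d (e j) v)\<^sup>2) = ip d a a / r\<^sup>2 * (\<Sum>j<k. (ip d (\<lambda>i. r * e j i) v)\<^sup>2)"
    using assms(4) by (simp add: ip_scale_left power_mult_distrib flip: sum_distrib_left)
  also have "\<dots> \<le> ip d a a / r\<^sup>2 * ip d v (mv d ?N v)"
    using pos_def_nonneg[OF assms(1), of v]
    by (intro mult_left_mono) (simp_all add: ip_mv_add_gram power2_eq_square ip_self_nonneg)
  finally show "(ip d a v)\<^sup>2 \<le> ip d a a / r\<^sup>2 * ip d v (mv d ?N v)" .
qed

lemma potential_le_exp:
  fixes \<beta> :: real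
  assumes "pos_def d N" "finite S" "\<And>s. s \<in> S \<Longrightarrow> inv_ip d N (x s) (x s) \<le> \<beta>"
  shows "potential d N x S \<le> exp (card S * \<beta>)"
proof -
  have "potential d N x S \<le> (\<Prod>s\<in>S. exp \<beta>)"
    unfolding potential_def
  proof (intro prod_mono conjI)
    fix s assume s_in: "s \<in> S"
    have "pos_def d (add_gram N x (past S s))" using assms(1,2) by (simp add: pos_def_add_gram)
    then show "0 \<le> 1 + inv_ip d (add_gram N x (past S s)) (x s) (x s)"
      by (simp add: inv_ip_nonneg)
    have "inv_ip d (add_gram N x (past S s)) (x s) (x s) \<le> \<beta>"
      using inv_ip_add_gram_antimono[OF assms(1), of "past S s" "{}" x "x s"] assms(2) assms(3)[OF s_in] by simp
    then show "1 + inv_ip d (add_gram N x (past S s)) (x s) (x s) \<le> exp \<beta>"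
      using exp_ge_add_one_self[of \<beta>] by linarith
  qed
  then show ?thesis by (simp add: exp_of_nat_mult)
qed

lemma Mmat_eq_add_gram: "Mmat C x S = add_gram (scaled_id (1 / C\<^sup>2)) x S"
  by (simp add: Mmat_def add_gram_def scaled_id_def)

text \<open>First add \<open>\<surd>n\<close> times an orthonormal basis of the subspace to the design: these \<open>k\<close> vectors have
  potential at most \<open>(1 + C\<^sup>2 n)\<^sup>k\<close>, and every later vector has squared norm at most \<open>1 / n\<close>.\<close>
lemma potential_subspace_le:
  assumes "in_subspace_dim d k (x ` S)" "finite S" "card S \<le> n" "n > 0" "C > 0"
    and x_norm: "\<And>s. s \<in> S \<Longrightarrow> ip d (x s) (x s) \<le> 1"
  shows "potential d (scaled_id (1 / C\<^sup>2)) x S \<le> (1 + C\<^sup>2 * n) ^ k * exp 1"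
proof -
  let ?N = "scaled_id (1 / C\<^sup>2)"
  obtain B where span_B: "\<And>s. s \<in> S \<Longrightarrow> \<exists>c. \<forall>i<d. x s i = (\<Sum>j<k. c j * B j i)"
    using assms(1) unfolding in_subspace_dim_def by blast
  obtain e where orthonormal_e: "orthonormal_or_0 d k e"
    and span_e: "\<And>c. \<exists>w. \<forall>i<d. (\<Sum>j<k. c j * B j i) = (\<Sum>j<k. w j * e j i)"
    using Gram_Schmidt[of d k B] by blast
  define f where "f = (\<lambda>j i. sqrt n * e j i)"
  have pos_def_N: "pos_def d ?N" using assms(5) by (simp add: pos_def_scaled_id)
  have pos_def_Nf: "pos_def d (add_gram ?N f {..<k})" using pos_def_N by (simp add: pos_def_add_gram)
  have "inv_ip d ?N (f j) (f j) \<le> C\<^sup>2 * n" if "j < k" for j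
  proof -
    have "ip d (e j) (e j) \<le> 1" using orthonormal_e that by (force simp: orthonormal_or_0_def)
    then have "C\<^sup>2 * n * ip d (e j) (e j) \<le> C\<^sup>2 * n" by (simp add: mult_left_le)
    moreover have "inv_ip d ?N (f j) (f j) = C\<^sup>2 * n * ip d (e j) (e j)"
      using assms(5) unfolding f_def
      by (simp add: inv_ip_scaled_id ip_scale_left ip_scale_right flip: mult.assoc)
    ultimately show ?thesis by simp
  qed
  then have "potential d ?N x S \<le> (1 + C\<^sup>2 * n) ^ k * potential d (add_gram ?N f {..<k}) x S"
    using potential_le_add_gram[OF pos_def_N assms(2), of "{..<k}" f "C\<^sup>2 * n" x] by simp
  also have "potential d (add_gram ?N f {..<k}) x S \<le> exp (card S * (1 / n))"
  proof (intro potential_le_exp pos_def_Nf assms(2))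
    fix s assume s_in: "s \<in> S"
    then obtain w where "\<And>i. i < d \<Longrightarrow> x s i = (\<Sum>j<k. w j * e j i)"
      using span_B span_e by metis
    from inv_ip_add_orthonormal_le[OF pos_def_N orthonormal_e this, of "sqrt n"] x_norm[OF s_in] assms(4)
    show "inv_ip d (add_gram ?N f {..<k}) (x s) (x s) \<le> 1 / n"
      by (simp add: f_def divide_right_mono order_trans)
  qed
  also have "\<dots> \<le> exp 1" using assms(3,4) by simp
  finally show ?thesis by (simp add: mult_left_mono)
qed

lemma elliptic_potential:
  assumes "in_subspace_dim d k (x ` S)" "finite S" "card S \<le> n" "n > 0" "C > 0"
    and "\<And>s. s \<in> S \<Longrightarrow> ip d (x s) (x s) \<le> 1"
  shows "(\<Sum>s\<in>S. ln (1 + inv_ip d (Mmat C x (past S s)) (x s) (x s))) \<le> k * ln (1 + C\<^sup>2 * n) + 1"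
proof -
  let ?N = "scaled_id (1 / C\<^sup>2)"
  have pos_def_N: "pos_def d ?N" using assms(5) by (simp add: pos_def_scaled_id)
  have factor_pos: "1 + inv_ip d (add_gram ?N x (past S s)) (x s) (x s) > 0" for s
    using inv_ip_nonneg[OF pos_def_add_gram[OF pos_def_N, of "past S s" x], of "x s"] assms(2) by simp
  have base_pos: "1 + C\<^sup>2 * real n > 0" by (simp add: add_pos_nonneg)
  have "(\<Sum>s\<in>S. ln (1 + inv_ip d (Mmat C x (past S s)) (x s) (x s))) = ln (potential d ?N x S)"
    unfolding potential_def Mmat_eq_add_gram
    by (rule ln_prod[symmetric, OF assms(2) factor_pos[THEN less_imp_neq, THEN not_sym]])
  also have "\<dots> \<le> ln ((1 + C\<^sup>2 * n) ^ k * exp 1)"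
    using potential_subspace_le[OF assms] factor_pos
    by (intro ln_mono) (auto simp: potential_def intro!: prod_pos)
  also have "\<dots> = k * ln (1 + C\<^sup>2 * n) + 1"
    using base_pos by (simp add: ln_mult ln_realpow)
  finally show ?thesis .
qed

section \<open>Prediction error and leverage\<close>

lemma min_1_le_two_ln:
  assumes "0 \<le> (z::real)"
  shows "min 1 z \<le> 2 * ln (1 + z)"
proof -
  have "min 1 z \<le> 2 * (z / (1 + z))"
    using assms mult_left_mono[of z 1 z] by (cases "z \<le> 1") (auto simp: pos_le_divide_eq distrib_left)
  also have "z / (1 + z) = 1 - 1 / (1 + z)"
    using assms by (simp add: field_simps)
  also have "\<dots> \<le> - ln (1 / (1 + z))"
    using ln_le_minus_one[of "1 / (1 + z)"] assms by simp
  also have "\<dots> = ln (1 + z)"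
    using assms by (simp add: ln_div)
  finally show ?thesis by simp
qed

lemma sum_le_sqrt_card:
  fixes f :: "'a \<Rightarrow> real"
  shows "(\<Sum>t\<in>A. f t) \<le> sqrt (card A * (\<Sum>t\<in>A. (f t)\<^sup>2))"
  using Cauchy_Schwarz_ineq_sum[of "\<lambda>_. 1" f A] by (intro real_le_rsqrt) simp

lemma sum_min_1_le_sqrt:
  fixes f :: "'a \<Rightarrow> real" and \<alpha> V :: real
  assumes "\<alpha> > 0" "\<And>t. t \<in> A \<Longrightarrow> f t \<ge> 0" "(\<Sum>t\<in>A. min 1 (\<alpha> * f t) * f t) \<le> V"
  shows "(\<Sum>t\<in>A. min 1 (\<alpha> * f t)) \<le> sqrt (card A * (\<alpha> * V))"
proof -
  have "(\<Sum>t\<in>A. (min 1 (\<alpha> * f t))\<^sup>2) \<le> (\<Sum>t\<in>A. \<alpha> * (min 1 (\<alpha> * f t) * f t))"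
  proof (rule sum_mono)
    fix t assume "t \<in> A"
    then have "min 1 (\<alpha> * f t) * min 1 (\<alpha> * f t) \<le> min 1 (\<alpha> * f t) * (\<alpha> * f t)"
      using assms(1,2) by (intro mult_left_mono) auto
    then show "(min 1 (\<alpha> * f t))\<^sup>2 \<le> \<alpha> * (min 1 (\<alpha> * f t) * f t)"
      by (simp add: power2_eq_square mult.left_commute)
  qed
  also have "\<dots> \<le> \<alpha> * V"
    using assms(1,3) by (simp flip: sum_distrib_left)
  finally have "sqrt (card A * (\<Sum>t\<in>A. (min 1 (\<alpha> * f t))\<^sup>2)) \<le> sqrt (card A * (\<alpha> * V))"
    by (simp add: mult_left_mono)
  with sum_le_sqrt_card show ?thesis by (rule order_trans)
qed

lemma sum_le_add_sqrt:
  fixes f :: "'a \<Rightarrow> real" and \<alpha> V :: real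
  assumes "\<alpha> > 0" "\<And>t. t \<in> A \<Longrightarrow> f t \<ge> 0" "(\<Sum>t\<in>A. min 1 (\<alpha> * f t) * f t) \<le> V"
  shows "(\<Sum>t\<in>A. f t) \<le> V + sqrt (card A * (V / \<alpha>))"
proof -
  define g where "g t = min 1 (\<alpha> * f t) * f t" for t
  have "f t \<le> g t + sqrt (g t / \<alpha>)" if "t \<in> A" for t
    using assms(1) assms(2)[OF that] by (cases "\<alpha> * f t \<ge> 1") (auto simp: g_def min_def)
  then have "(\<Sum>t\<in>A. f t) \<le> (\<Sum>t\<in>A. g t) + (\<Sum>t\<in>A. sqrt (g t / \<alpha>))"
    by (simp add: sum_mono flip: sum.distrib)
  also have "\<dots> \<le> V + sqrt (card A * (\<Sum>t\<in>A. (sqrt (g t / \<alpha>))\<^sup>2))"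
    using assms(3) by (intro add_mono sum_le_sqrt_card) (simp add: g_def)
  also have "(\<Sum>t\<in>A. (sqrt (g t / \<alpha>))\<^sup>2) = (\<Sum>t\<in>A. g t) / \<alpha>"
    using assms(1,2) by (simp add: g_def sum_divide_distrib)
  also have "V + sqrt (card A * ((\<Sum>t\<in>A. g t) / \<alpha>)) \<le> V + sqrt (card A * (V / \<alpha>))"
    using assms(1,3) by (simp add: g_def divide_right_mono mult_left_mono)
  finally show ?thesis .
qed

lemma etat_ge_1: "1 \<le> etat eta"
  by (simp add: etat_def)

lemma clip_error_le:
  assumes "\<bar>b\<bar> \<le> 1"
  shows "\<bar>clip a - b\<bar> \<le> \<bar>a - b\<bar>" "\<bar>clip a - b\<bar> \<le> 2"
  using assms by (auto simp: clip_def min_def max_def)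

locale qufur =
  fixes d :: nat and C eta alpha :: real and x :: "nat \<Rightarrow> nat \<Rightarrow> real"
  assumes C_pos: "C > 0" and alpha_pos: "alpha > 0"
begin

text \<open>Throughout, \<open>R\<close> is the set of rounds queried before round \<open>t\<close>; the leverage is the squared norm
  \<open>\<parallel>x\<^sub>t\<parallel>\<^sup>2\<close> with respect to \<open>M\<^sub>t\<^sup>-\<^sup>1\<close>.\<close>
definition leverage :: "nat set \<Rightarrow> nat \<Rightarrow> real" where
  "leverage R t = inv_ip d (Mmat C x R) (x t) (x t)"

definition uncertainty :: "nat set \<Rightarrow> nat \<Rightarrow> real" where
  "uncertainty R t = min 1 (leverage R t)"

abbreviation Delta :: "nat set \<Rightarrow> nat \<Rightarrow> real" where
  "Delta \<equiv> delta d C eta x"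

definition query_prob :: "nat set \<Rightarrow> nat \<Rightarrow> real" where
  "query_prob R t = min 1 (alpha * Delta R t)"

definition weight :: "nat set \<Rightarrow> nat \<Rightarrow> nat \<Rightarrow> real" where
  "weight R t s = inv_ip d (Mmat C x R) (x s) (x t)"

definition estimate :: "nat set \<Rightarrow> (nat \<Rightarrow> real) \<Rightarrow> nat \<Rightarrow> real" where
  "estimate R y t = (\<Sum>s\<in>R. weight R t s * y s)"

lemma pos_def_Mmat: "finite R \<Longrightarrow> pos_def d (Mmat C x R)"
  using C_pos by (simp add: Mmat_eq_add_gram pos_def_add_gram pos_def_scaled_id)

lemma ip_mv_Mmat:
  "finite R \<Longrightarrow> ip d u (mv d (Mmat C x R) v) = ip d u v / C\<^sup>2 + (\<Sum>s\<in>R. ip d (x s) u * ip d (x s) v)"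
  by (simp add: Mmat_eq_add_gram ip_mv_add_gram ip_mv_scaled_id)

lemma leverage_nonneg: "finite R \<Longrightarrow> 0 \<le> leverage R t"
  by (simp add: leverage_def inv_ip_nonneg pos_def_Mmat)

lemma leverage_antimono: "finite R' \<Longrightarrow> R \<subseteq> R' \<Longrightarrow> leverage R' t \<le> leverage R t"
  unfolding leverage_def Mmat_eq_add_gram
  using C_pos by (intro inv_ip_add_gram_antimono pos_def_scaled_id) simp_all

lemma uncertainty_bounds: "finite R \<Longrightarrow> 0 \<le> uncertainty R t" "uncertainty R t \<le> 1"
  by (simp_all add: uncertainty_def leverage_nonneg)

lemma Delta_eq: "Delta R t = (etat eta)\<^sup>2 * uncertainty R t"
  by (simp add: delta_def uncertainty_def leverage_def inv_ip_def)

lemma Delta_nonneg: "finite R \<Longrightarrow> 0 \<le> Delta R t"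
  by (simp add: Delta_eq uncertainty_bounds)

lemma query_prob_bounds:
  assumes "finite R"
  shows "0 \<le> query_prob R t" "query_prob R t \<le> 1"
  using alpha_pos Delta_nonneg[OF assms] by (simp_all add: query_prob_def)

lemma ip_msolve_eq_estimate:
  assumes "finite R"
  shows "ip d (msolve d (Mmat C x R) (\<lambda>i. \<Sum>s\<in>R. x s i * y s)) (x t) = estimate R y t"
proof -
  have "ip d (msolve d (Mmat C x R) (\<lambda>i. \<Sum>s\<in>R. x s i * y s)) (x t)
      = inv_ip d (Mmat C x R) (\<lambda>i. \<Sum>s\<in>R. x s i * y s) (x t)"
    unfolding ip_commute[of d _ "x t"] inv_ip_def[symmetric]
    by (rule inv_ip_commute[OF pos_def_Mmat[OF assms]])
  then show ?thesis
    by (simp add: inv_ip_def estimate_def weight_def ip_sum_left mult.commute[of _ "y _"] ip_scale_left)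
qed

lemma leverage_eq:
  assumes "finite R"
  shows "leverage R t = ip d (msolve d (Mmat C x R) (x t)) (msolve d (Mmat C x R) (x t)) / C\<^sup>2
    + (\<Sum>s\<in>R. (weight R t s)\<^sup>2)"
  unfolding leverage_def inv_ip_self[OF pos_def_Mmat[OF assms]] ip_mv_Mmat[OF assms]
  by (simp add: weight_def inv_ip_def power2_eq_square)

lemma sum_weight_squares_le: "finite R \<Longrightarrow> (\<Sum>s\<in>R. (weight R t s)\<^sup>2) \<le> leverage R t"
  by (simp add: leverage_eq ip_self_nonneg)

lemma estimate_bias_le:
  assumes "finite R" "sqrt (ip d theta theta) \<le> C"
  shows "\<bar>estimate R (\<lambda>s. ip d theta (x s)) t - ip d theta (x t)\<bar> \<le> sqrt (leverage R t)"
proof -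
  define w where "w = msolve d (Mmat C x R) (x t)"
  have "ip d theta (x t) = ip d theta w / C\<^sup>2 + (\<Sum>s\<in>R. ip d (x s) theta * ip d (x s) w)"
    using ip_mv_msolve[OF pos_def_Mmat[OF assms(1)], of theta "x t"]
    by (simp add: ip_mv_Mmat[OF assms(1)] w_def)
  then have bias: "estimate R (\<lambda>s. ip d theta (x s)) t - ip d theta (x t) = - (ip d theta w / C\<^sup>2)"
    by (simp add: estimate_def weight_def inv_ip_def w_def ip_commute[of d theta "x _"] mult.commute)
  have "ip d theta theta \<le> C\<^sup>2"
    using assms(2) C_pos by (intro sqrt_le_D)
  then have "(ip d theta w)\<^sup>2 \<le> C\<^sup>2 * ip d w w"
    by (intro order_trans[OF ip_Cauchy_Schwarz mult_right_mono] ip_self_nonneg)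
  then have "(ip d theta w / C\<^sup>2)\<^sup>2 \<le> ip d w w / C\<^sup>2"
    using C_pos by (simp add: power_divide field_simps power2_eq_square)
  also have "\<dots> \<le> leverage R t"
    by (simp add: leverage_eq[OF assms(1)] w_def sum_nonneg)
  finally have "\<bar>ip d theta w / C\<^sup>2\<bar> \<le> sqrt (leverage R t)"
    by (intro real_le_rsqrt) (simp add: power_divide)
  then show ?thesis by (simp add: bias)
qed

lemma prediction_error_le:
  assumes "finite R" "sqrt (ip d theta theta) \<le> C" "\<bar>ip d theta (x t)\<bar> \<le> 1" "\<Gamma> \<ge> 1"
    and noise: "\<bar>estimate R \<xi> t\<bar> \<le> \<Gamma> * (etat eta * sqrt (leverage R t))"
  shows "(clip (estimate R (\<lambda>s. ip d theta (x s) + \<xi> s) t) - ip d theta (x t))\<^sup>2 \<le> 4 * \<Gamma>\<^sup>2 * Delta R t"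
proof -
  define e where "e = clip (estimate R (\<lambda>s. ip d theta (x s) + \<xi> s) t) - ip d theta (x t)"
  define l where "l = leverage R t"
  define g where "g = \<Gamma> * etat eta"
  have l_nonneg: "0 \<le> l" using assms(1) by (simp add: l_def leverage_nonneg)
  have g_ge_1: "1 \<le> g" using assms(4) etat_ge_1[of eta] mult_mono[of 1 \<Gamma> 1 "etat eta"] by (simp add: g_def)
  have "estimate R (\<lambda>s. ip d theta (x s) + \<xi> s) t
      = estimate R (\<lambda>s. ip d theta (x s)) t + estimate R \<xi> t"
    by (simp add: estimate_def distrib_left sum.distrib)
  then have "\<bar>e\<bar> \<le> \<bar>estimate R (\<lambda>s. ip d theta (x s)) t - ip d theta (x t)\<bar> + \<bar>estimate R \<xi> t\<bar>"
    using clip_error_le(1)[OF assms(3)] unfolding e_def by (smt (verit))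
  also have "\<dots> \<le> sqrt l + g * sqrt l"
    unfolding l_def g_def mult.assoc by (intro add_mono estimate_bias_le assms(1,2) noise)
  also have "\<dots> \<le> 2 * g * sqrt l"
    using mult_right_mono[OF g_ge_1, of "sqrt l"] l_nonneg by simp
  finally have "e\<^sup>2 \<le> (2 * g * sqrt l)\<^sup>2"
    using l_nonneg g_ge_1 by (simp add: power2_le_iff_abs_le)
  moreover have "\<bar>e\<bar> \<le> 2 * g"
    unfolding e_def using g_ge_1 by (intro order_trans[OF clip_error_le(2)[OF assms(3)]]) simp
  then have "e\<^sup>2 \<le> (2 * g)\<^sup>2"
    using g_ge_1 by (subst power2_le_iff_abs_le) simp_all
  ultimately have "e\<^sup>2 \<le> 4 * g\<^sup>2 * min 1 l"
    using l_nonneg by (simp add: power_mult_distrib min_def)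
  then show ?thesis
    by (simp add: e_def g_def l_def Delta_eq uncertainty_def power_mult_distrib mult.assoc)
qed

text \<open>Dropping the queries outside \<open>A\<close> from the design only increases the leverages, so the potential
  argument can be run inside the subspace containing \<open>A\<close>.\<close>
lemma sum_uncertainty_subspace_le:
  assumes "in_subspace_dim d k (x ` A)" "finite A" "card A \<le> n" "n > 0"
    and "\<And>t. t \<in> A \<Longrightarrow> ip d (x t) (x t) \<le> 1"
  shows "(\<Sum>t\<in>A \<inter> S. uncertainty (past S t) t) \<le> 2 * (k * ln (1 + C\<^sup>2 * n) + 1)"
proof -
  have "(\<Sum>t\<in>A \<inter> S. uncertainty (past S t) t) \<le> (\<Sum>t\<in>A \<inter> S. 2 * ln (1 + leverage (past (A \<inter> S) t) t))"
  proof (rule sum_mono)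
    fix t
    have "uncertainty (past S t) t \<le> min 1 (leverage (past (A \<inter> S) t) t)"
      unfolding uncertainty_def by (intro min.mono order_refl leverage_antimono) auto
    also have "\<dots> \<le> 2 * ln (1 + leverage (past (A \<inter> S) t) t)"
      by (intro min_1_le_two_ln leverage_nonneg) simp
    finally show "uncertainty (past S t) t \<le> 2 * ln (1 + leverage (past (A \<inter> S) t) t)" .
  qed
  also have "\<dots> = 2 * (\<Sum>t\<in>A \<inter> S. ln (1 + leverage (past (A \<inter> S) t) t))"
    by (simp add: sum_distrib_left)
  also have "\<dots> \<le> 2 * (k * ln (1 + C\<^sup>2 * n) + 1)"
  proof -
    have "in_subspace_dim d k (x ` (A \<inter> S))"
      using assms(1) unfolding in_subspace_dim_def by blast
    moreover have "card (A \<inter> S) \<le> n"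
      using card_mono[of A "A \<inter> S"] assms(2,3) by simp
    ultimately show ?thesis
      unfolding leverage_def using elliptic_potential[of d k x "A \<inter> S" n C] assms(2,4,5) C_pos by simp
  qed
  finally show ?thesis .
qed

abbreviation queried :: "(nat \<Rightarrow> real) \<Rightarrow> nat \<Rightarrow> nat set" where
  "queried \<equiv> qset d C eta alpha x"

lemma queried_subset: "queried U n \<subseteq> {1..n}"
  by (induction n) (auto simp: Let_def)

lemma finite_queried: "finite (queried U n)"
  using queried_subset finite_subset by blast

lemma past_queried: "n \<le> T \<Longrightarrow> past (queried U T) (Suc n) = queried U n"
proof (induction T)
  case (Suc T)
  show ?case
  proof (cases "n = Suc T")
    case True
    then show ?thesis using queried_subset[of U n] by auto
  next
    case False
    then show ?thesis using Suc by (auto simp: Let_def)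
  qed
qed simp

lemma mem_queried_iff:
  assumes "t \<in> {1..T}"
  shows "t \<in> queried U T \<longleftrightarrow> U t < query_prob (past (queried U T) t) t"
proof -
  obtain n where t_eq_Suc: "t = Suc n" "n < T" using assms by (cases t) auto
  have "t \<in> queried U T \<longleftrightarrow> t \<in> past (queried U T) (Suc t)" by simp
  also have "past (queried U T) (Suc t) = queried U (Suc n)"
    using past_queried[of t T U] t_eq_Suc by simp
  also have "t \<in> \<dots> \<longleftrightarrow> U t < query_prob (queried U n) t"
    using queried_subset[of U n] by (auto simp: t_eq_Suc(1) query_prob_def Let_def)
  also have "queried U n = past (queried U T) t"
    using t_eq_Suc by (simp add: past_queried)
  finally show ?thesis .
qed

lemma queried_eq_iff:
  assumes "S \<subseteq> {1..T}"
  shows "queried U T = S \<longleftrightarrow> (\<forall>t\<in>{1..T}. U t < query_prob (past S t) t \<longleftrightarrow> t \<in> S)"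
proof
  assume coins: "\<forall>t\<in>{1..T}. U t < query_prob (past S t) t \<longleftrightarrow> t \<in> S"
  have "t \<in> queried U T \<longleftrightarrow> t \<in> S" if "t \<in> {1..T}" for t
    using that
  proof (induction t rule: less_induct)
    case (less t)
    have "past (queried U T) t = past S t"
      using less queried_subset[of U T] assms by (auto simp: subset_iff)
    then show ?case
      using coins less.prems by (simp add: mem_queried_iff)
  qed
  then show "queried U T = S"
    using queried_subset[of U T] assms by blast
qed (use mem_queried_iff in blast)

lemma regret_eq:
  "regret d C eta alpha x U y theta T =
    (\<Sum>t=1..T. (clip (estimate (past (queried U T) t) y t) - ip d theta (x t))\<^sup>2)"
  unfolding regret_def
proof (intro sum.cong refl)
  fix t assume "t \<in> {1..T}"
  then have "past (queried U T) t = queried U (t - 1)"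
    by (cases t) (simp_all add: past_queried)
  then have "yhat d C eta alpha x U y t = clip (estimate (past (queried U T) t) y t)"
    by (simp add: yhat_def ip_msolve_eq_estimate finite_queried)
  then show "(yhat d C eta alpha x U y t - ip d theta (x t))\<^sup>2 =
      (clip (estimate (past (queried U T) t) y t) - ip d theta (x t))\<^sup>2"
    by simp
qed

end

section \<open>Law of the queried set and exponential tail bounds\<close>

lemma sum_Pow_insert:
  fixes f :: "'a set \<Rightarrow> 'b::comm_monoid_add"
  assumes "finite A" "a \<notin> A"
  shows "(\<Sum>S\<in>Pow (insert a A). f S) = (\<Sum>S\<in>Pow A. f S + f (insert a S))"
proof -
  have "(\<Sum>S\<in>Pow (insert a A). f S) = (\<Sum>S\<in>Pow A. f S) + (\<Sum>S\<in>insert a ` Pow A. f S)"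
    unfolding Pow_insert using assms by (intro sum.union_disjoint) auto
  also have "(\<Sum>S\<in>insert a ` Pow A. f S) = (\<Sum>S\<in>Pow A. f (insert a S))"
    using assms(2) by (subst sum.reindex) (auto intro!: inj_onI simp: insert_ident)
  finally show ?thesis by (simp add: sum.distrib)
qed

lemma sum_Pow_prod_history_le_1:
  fixes k :: "'a::linorder \<Rightarrow> 'a set \<Rightarrow> bool \<Rightarrow> real"
  assumes "finite A" "\<And>t R b. finite R \<Longrightarrow> 0 \<le> k t R b"
    and "\<And>t R. finite R \<Longrightarrow> k t R True + k t R False \<le> 1"
  shows "(\<Sum>S\<in>Pow A. \<Prod>t\<in>A. k t (past S t) (t \<in> S)) \<le> 1"
  using assms(1)
proof (induction A rule: finite_linorder_max_induct)
  case (insert b A)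
  define F where "F B S = (\<Prod>t\<in>B. k t (past S t) (t \<in> S))" for B S
  have "b \<notin> A" using insert.hyps(2) by blast
  have step: "F (insert b A) S + F (insert b A) (insert b S) = (k b S True + k b S False) * F A S"
    if S_subset: "S \<subseteq> A" for S
  proof -
    have past_b: "past S b = S" "past (insert b S) b = S" and "b \<notin> S"
      using S_subset insert.hyps(2) by auto
    have "past (insert b S) t = past S t \<and> (t \<in> insert b S \<longleftrightarrow> t \<in> S)" if "t \<in> A" for t
      using insert.hyps(2) that by auto
    then have "F A (insert b S) = F A S"
      unfolding F_def by (intro prod.cong) auto
    then show ?thesis
      using insert.hyps(1) \<open>b \<notin> A\<close> past_b \<open>b \<notin> S\<close> by (simp add: F_def distrib_right)
  qed
  have "(\<Sum>S\<in>Pow (insert b A). F (insert b A) S) = (\<Sum>S\<in>Pow A. (k b S True + k b S False) * F A S)"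
    using insert.hyps(1) \<open>b \<notin> A\<close> by (subst sum_Pow_insert) (auto intro!: sum.cong step)
  also have "\<dots> \<le> (\<Sum>S\<in>Pow A. 1 * F A S)"
  proof (intro sum_mono mult_right_mono assms(3))
    fix S assume "S \<in> Pow A"
    then show "finite S" using insert.hyps(1) finite_subset by blast
    then show "0 \<le> F A S" unfolding F_def by (intro prod_nonneg) (simp add: assms(2))
  qed
  also have "\<dots> \<le> 1" using insert.IH by (simp add: F_def)
  finally show ?case by (simp add: F_def)
qed simp

lemma exp_lower_tail_step:
  fixes p h :: real
  assumes "0 \<le> p" "p \<le> 1" "0 \<le> h" "h \<le> 1"
  shows "p * exp (p * h / 2 - h) + (1 - p) * exp (p * h / 2) \<le> 1"
proof -
  have "exp (- h) \<le> 1 / (1 + h)"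
    using exp_ge_add_one_self[of h] assms by (simp add: exp_minus field_simps)
  also have "\<dots> \<le> 1 - h / 2"
  proof -
    have "h * h \<le> h" using assms by (simp add: mult_left_le)
    then have "1 \<le> (1 - h / 2) * (1 + h)" by (simp add: algebra_simps)
    then show ?thesis using assms by (simp add: divide_le_eq)
  qed
  finally have drift: "p * (h / 2) \<le> p * (1 - exp (- h))" using assms by (intro mult_left_mono) auto
  have "p * exp (p * h / 2 - h) + (1 - p) * exp (p * h / 2) = exp (p * h / 2) * (1 + - (p * (1 - exp (- h))))"
    by (simp add: exp_diff exp_minus algebra_simps inverse_eq_divide)
  also have "\<dots> \<le> exp (p * h / 2) * exp (- (p * (1 - exp (- h))))"
    by (intro mult_left_mono exp_ge_add_one_self) simp
  also have "\<dots> = exp (p * (h / 2) - p * (1 - exp (- h)))" by (simp add: exp_add[symmetric])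
  also have "\<dots> \<le> 1" using drift by simp
  finally show ?thesis .
qed

lemma exp_upper_tail_step:
  fixes p :: real
  assumes "0 \<le> p"
  shows "p * exp (1 - 2 * p) + (1 - p) * exp (- 2 * p) \<le> 1"
proof -
  have "p * exp (1 - 2 * p) + (1 - p) * exp (- 2 * p) = exp (- 2 * p) * (1 + p * (exp 1 - 1))"
    by (simp add: exp_diff exp_minus field_simps)
  also have "\<dots> \<le> exp (- 2 * p) * (1 + 2 * p)"
    using exp_le mult_left_mono[OF _ assms, of "exp 1 - 1" 2] by (intro mult_left_mono) auto
  also have "\<dots> \<le> exp (- 2 * p) * exp (2 * p)"
    by (intro mult_left_mono exp_ge_add_one_self) simp
  also have "\<dots> = 1" by (simp add: exp_add[symmetric])
  finally show ?thesis .
qed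

lemma (in prob_space) expectation_uniform_less:
  assumes uniform_U: "random_variable borel U" "distr M borel U = uniform_measure lborel {0..1::real}"
    and "0 \<le> p" "p \<le> 1"
  shows "expectation (\<lambda>\<omega>. of_bool (U \<omega> < p \<longleftrightarrow> b)) = (if b then p else 1 - p)"
proof -
  note [measurable] = uniform_U(1)
  have "prob {\<omega> \<in> space M. U \<omega> < p} = measure (distr M borel U) {..<p}"
    by (subst measure_distr[OF uniform_U(1)]) (auto intro: arg_cong[where f = prob])
  also have "\<dots> = measure lborel ({0..1} \<inter> {..<p}) / measure lborel {0..1::real}"
    unfolding uniform_U(2) by (rule measure_uniform_measure) auto
  also have "{0..1} \<inter> {..<p} = {0..<p}" using assms by auto
  finally have prob_less: "prob {\<omega> \<in> space M. U \<omega> < p} = p" using assms by simp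
  have "expectation (\<lambda>\<omega>. of_bool (U \<omega> < p \<longleftrightarrow> b))
      = expectation (indicat_real {\<omega> \<in> space M. U \<omega> < p \<longleftrightarrow> b})"
    by (intro Bochner_Integration.integral_cong) (auto simp: indicator_def)
  also have "\<dots> = prob {\<omega> \<in> space M. U \<omega> < p \<longleftrightarrow> b}"
    by (simp add: Int_absorb2)
  also have "\<dots> = (if b then p else 1 - p)"
    using prob_less prob_neg[of "\<lambda>\<omega>. U \<omega> < p"] by simp
  finally show ?thesis .
qed

context qufur
begin

definition qset_prob :: "nat \<Rightarrow> nat set \<Rightarrow> real" where
  "qset_prob T S =
     (\<Prod>t\<in>{1..T}. if t \<in> S then query_prob (past S t) t else 1 - query_prob (past S t) t)"

lemma qset_prob_nonneg: "0 \<le> qset_prob T S"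
  unfolding qset_prob_def using query_prob_bounds by (intro prod_nonneg) auto

text \<open>Given the history \<open>R\<close>, round \<open>t\<close> is queried with probability \<open>query_prob R t\<close>: the exponential of
  the increment has conditional mean at most 1.\<close>
definition supermartingale_increment :: "(nat \<Rightarrow> nat set \<Rightarrow> bool \<Rightarrow> real) \<Rightarrow> bool" where
  "supermartingale_increment g \<longleftrightarrow> (\<forall>t R. finite R \<longrightarrow>
    query_prob R t * exp (g t R True) + (1 - query_prob R t) * exp (g t R False) \<le> 1)"

lemma sum_qset_prob_exp_le_1:
  assumes "supermartingale_increment g"
  shows "(\<Sum>S\<in>Pow {1..T}. qset_prob T S * exp (\<Sum>t\<in>{1..T}. g t (past S t) (t \<in> S))) \<le> 1"
proof -
  define k where "k t R b = (if b then query_prob R t else 1 - query_prob R t) * exp (g t R b)" for t R b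
  have "(\<Sum>S\<in>Pow {1..T}. \<Prod>t\<in>{1..T}. k t (past S t) (t \<in> S)) \<le> 1"
    using assms query_prob_bounds
    by (intro sum_Pow_prod_history_le_1) (auto simp: k_def supermartingale_increment_def)
  then show ?thesis
    by (simp add: k_def prod.distrib qset_prob_def exp_sum)
qed

lemma sum_qset_prob_le_1: "(\<Sum>S\<in>Pow {1..T}. qset_prob T S) \<le> 1"
  using sum_qset_prob_exp_le_1[of "\<lambda>_ _ _. 0"] by (simp add: supermartingale_increment_def)

lemma supermartingale_increment_query:
  "supermartingale_increment (\<lambda>t R b. of_bool b - 2 * query_prob R t)"
  unfolding supermartingale_increment_def
  using exp_upper_tail_step[OF query_prob_bounds(1)] by simp

lemma supermartingale_increment_uncertainty:
  "supermartingale_increment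
    (\<lambda>t R b. of_bool (t \<in> A) * (query_prob R t * uncertainty R t / 2 - of_bool b * uncertainty R t))"
  unfolding supermartingale_increment_def
  using exp_lower_tail_step[OF query_prob_bounds uncertainty_bounds] by simp

text \<open>Division by 0 makes the weights vanish when the leverage does.\<close>
definition normalized_weight :: "nat set \<Rightarrow> nat \<Rightarrow> nat \<Rightarrow> real" where
  "normalized_weight R t s = of_bool (s \<in> R) * weight R t s / (etat eta * sqrt (leverage R t))"

lemma sum_normalized_weight_squares_le:
  assumes "finite A" "R \<subseteq> A" "eta \<ge> 0"
  shows "eta\<^sup>2 * (\<Sum>s\<in>A. (normalized_weight R t s)\<^sup>2) \<le> 1"
proof -
  have "finite R" using assms finite_subset by blast
  have "(\<Sum>s\<in>A. (normalized_weight R t s)\<^sup>2) = (\<Sum>s\<in>R. (weight R t s / (etat eta * sqrt (leverage R t)))\<^sup>2)"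
    using assms(1,2) by (intro sum.mono_neutral_cong_right) (auto simp: normalized_weight_def)
  also have "\<dots> = (\<Sum>s\<in>R. (weight R t s)\<^sup>2) / ((etat eta)\<^sup>2 * leverage R t)"
    using leverage_nonneg[OF \<open>finite R\<close>] by (simp add: power_divide power_mult_distrib sum_divide_distrib)
  also have "\<dots> \<le> leverage R t / ((etat eta)\<^sup>2 * leverage R t)"
    using sum_weight_squares_le leverage_nonneg \<open>finite R\<close> by (intro divide_right_mono) auto
  also have "\<dots> \<le> 1 / (etat eta)\<^sup>2" by simp
  finally have "eta\<^sup>2 * (\<Sum>s\<in>A. (normalized_weight R t s)\<^sup>2) \<le> eta\<^sup>2 * (1 / (etat eta)\<^sup>2)"
    by (intro mult_left_mono) auto
  also have "\<dots> \<le> 1"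
    using assms(3) by (auto simp: etat_def intro!: power_mono)
  finally show ?thesis .
qed

lemma estimate_eq_normalized:
  assumes "finite A" "R \<subseteq> A"
  shows "estimate R \<xi> t = (\<Sum>s\<in>A. normalized_weight R t s * \<xi> s) * (etat eta * sqrt (leverage R t))"
proof (cases "leverage R t = 0")
  case True
  have "finite R" using assms finite_subset by blast
  then have "(\<Sum>s\<in>R. (weight R t s)\<^sup>2) = 0"
    using sum_weight_squares_le[of R t] True by (intro antisym sum_nonneg) auto
  then have "\<forall>s\<in>R. weight R t s = 0"
    using \<open>finite R\<close> by (simp add: sum_nonneg_eq_0_iff)
  then show ?thesis using True by (simp add: estimate_def)
next
  case False
  have "(\<Sum>s\<in>A. normalized_weight R t s * \<xi> s) = (\<Sum>s\<in>R. weight R t s * \<xi> s / (etat eta * sqrt (leverage R t)))"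
    using assms by (intro sum.mono_neutral_cong_right) (auto simp: normalized_weight_def)
  then show ?thesis
    using False etat_ge_1[of eta] by (simp add: estimate_def flip: sum_divide_distrib)
qed

end

locale qufur_noise = qufur +
  fixes T :: nat and M :: "omega measure"
  assumes eta_nonneg: "eta \<ge> 0" and noise_model: "noise_model M eta T"
begin

sublocale prob_space M
  using noise_model by (simp add: noise_model_def)

abbreviation Q :: "omega \<Rightarrow> nat set" where
  "Q \<omega> \<equiv> queried (snd \<omega>) T"

abbreviation history :: "omega \<Rightarrow> nat \<Rightarrow> nat set" where
  "history \<omega> t \<equiv> past (Q \<omega>) t"

lemma noise_borel_measurable: "t \<in> {1..T} \<Longrightarrow> (\<lambda>\<omega>. fst \<omega> t) \<in> borel_measurable M"
  and coin_borel_measurable: "t \<in> {1..T} \<Longrightarrow> (\<lambda>\<omega>. snd \<omega> t) \<in> borel_measurable M"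
  and distr_coin: "t \<in> {1..T} \<Longrightarrow> distr M borel (\<lambda>\<omega>. snd \<omega> t) = uniform_measure lborel {0..1}"
  and integrable_exp_noise: "t \<in> {1..T} \<Longrightarrow> integrable M (\<lambda>\<omega>. exp (l * fst \<omega> t))"
  and expectation_exp_noise_le:
    "t \<in> {1..T} \<Longrightarrow> expectation (\<lambda>\<omega>. exp (l * fst \<omega> t)) \<le> exp (l\<^sup>2 * eta\<^sup>2 / 2)"
  using noise_model unfolding noise_model_def by blast+

lemma
  fixes g h :: "nat \<Rightarrow> real \<Rightarrow> real"
  assumes measurable_gh: "\<And>t. g t \<in> borel_measurable borel" "\<And>t. h t \<in> borel_measurable borel"
    and integrable_gh: "\<And>t. t \<in> {1..T} \<Longrightarrow> integrable M (\<lambda>\<omega>. g t (fst \<omega> t))"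
      "\<And>t. t \<in> {1..T} \<Longrightarrow> integrable M (\<lambda>\<omega>. h t (snd \<omega> t))"
  shows integrable_noise_coin_prod:
      "integrable M (\<lambda>\<omega>. (\<Prod>t\<in>{1..T}. g t (fst \<omega> t)) * (\<Prod>t\<in>{1..T}. h t (snd \<omega> t)))" (is ?integrable)
    and expectation_noise_coin_prod:
      "expectation (\<lambda>\<omega>. (\<Prod>t\<in>{1..T}. g t (fst \<omega> t)) * (\<Prod>t\<in>{1..T}. h t (snd \<omega> t))) =
        (\<Prod>t\<in>{1..T}. expectation (\<lambda>\<omega>. g t (fst \<omega> t))) * (\<Prod>t\<in>{1..T}. expectation (\<lambda>\<omega>. h t (snd \<omega> t)))"
      (is ?expectation)
proof -
  define J :: "(nat + nat) set" where "J = Inl ` {1..T} \<union> Inr ` {1..T}"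
  define X :: "nat + nat \<Rightarrow> omega \<Rightarrow> real"
    where "X = (\<lambda>i. case i of Inl t \<Rightarrow> (\<lambda>\<omega>. fst \<omega> t) | Inr t \<Rightarrow> (\<lambda>\<omega>. snd \<omega> t))"
  define Y where "Y = (\<lambda>i \<omega>. (case i of Inl t \<Rightarrow> g t | Inr t \<Rightarrow> h t) (X i \<omega>))"
  have "indep_vars (\<lambda>_. borel) X J"
    using noise_model by (simp add: noise_model_def X_def J_def)
  then have indep: "indep_vars (\<lambda>_. borel) Y J"
    unfolding Y_def by (rule indep_vars_compose2) (auto simp: measurable_gh split: sum.split)
  have finite_J: "finite J" by (simp add: J_def)
  have prod_J: "(\<Prod>i\<in>J. f i) = (\<Prod>t\<in>{1..T}. f (Inl t)) * (\<Prod>t\<in>{1..T}. f (Inr t))" for f :: "nat + nat \<Rightarrow> real"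
    unfolding J_def by (subst prod.union_disjoint) (auto simp: prod.reindex)
  have integrable_Y: "integrable M (Y i)" if "i \<in> J" for i
    using that integrable_gh by (auto simp: J_def Y_def X_def)
  show ?integrable
    using indep_vars_integrable[OF finite_J indep integrable_Y] by (simp add: prod_J Y_def X_def)
  show ?expectation
    using indep_vars_lebesgue_integral[OF finite_J indep integrable_Y] by (simp add: prod_J Y_def X_def)
qed

lemma of_bool_Q_eq_prod:
  assumes "S \<subseteq> {1..T}"
  shows "of_bool (Q \<omega> = S) =
    (\<Prod>t\<in>{1..T}. of_bool (snd \<omega> t < query_prob (past S t) t \<longleftrightarrow> t \<in> S) :: real)"
  unfolding queried_eq_iff[OF assms]
  by (cases "\<forall>t\<in>{1..T}. snd \<omega> t < query_prob (past S t) t \<longleftrightarrow> t \<in> S") (auto intro!: prod_zero prod.neutral)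

lemma prod_expectation_coins:
  "(\<Prod>t\<in>{1..T}. expectation (\<lambda>\<omega>. of_bool (snd \<omega> t < query_prob (past S t) t \<longleftrightarrow> t \<in> S))) = qset_prob T S"
  unfolding qset_prob_def
proof (intro prod.cong refl)
  fix t assume t_in: "t \<in> {1..T}"
  have "finite (past S t)" by (rule finite_Int) simp
  then show "expectation (\<lambda>\<omega>. of_bool (snd \<omega> t < query_prob (past S t) t \<longleftrightarrow> t \<in> S)) =
      (if t \<in> S then query_prob (past S t) t else 1 - query_prob (past S t) t)"
    by (intro expectation_uniform_less coin_borel_measurable distr_coin query_prob_bounds t_in)
qed

lemma prod_expectation_exp_noise_le:
  "(\<Prod>t\<in>{1..T}. expectation (\<lambda>\<omega>. exp (c t * fst \<omega> t))) \<le> exp (eta\<^sup>2 / 2 * (\<Sum>t\<in>{1..T}. (c t)\<^sup>2))"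
proof -
  have "(\<Prod>t\<in>{1..T}. expectation (\<lambda>\<omega>. exp (c t * fst \<omega> t))) \<le> (\<Prod>t\<in>{1..T}. exp ((c t)\<^sup>2 * eta\<^sup>2 / 2))"
    using expectation_exp_noise_le by (intro prod_mono) auto
  then show ?thesis
    by (simp add: sum_distrib_left mult.commute flip: exp_sum)
qed

lemma
  fixes c :: "nat \<Rightarrow> real"
  assumes "S \<subseteq> {1..T}"
  shows integrable_exp_noise_on_Q:
      "integrable M (\<lambda>\<omega>. of_bool (Q \<omega> = S) * exp (\<Sum>s\<in>{1..T}. c s * fst \<omega> s))" (is "integrable M ?f")
    and expectation_exp_noise_on_Q_le:
      "expectation (\<lambda>\<omega>. of_bool (Q \<omega> = S) * exp (\<Sum>s\<in>{1..T}. c s * fst \<omega> s))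
        \<le> qset_prob T S * exp (eta\<^sup>2 / 2 * (\<Sum>s\<in>{1..T}. (c s)\<^sup>2))"
proof -
  define g where "g t r = exp (c t * r)" for t r
  define h :: "nat \<Rightarrow> real \<Rightarrow> real" where "h t r = of_bool (r < query_prob (past S t) t \<longleftrightarrow> t \<in> S)" for t r
  have f_eq_prod: "?f = (\<lambda>\<omega>. (\<Prod>t\<in>{1..T}. g t (fst \<omega> t)) * (\<Prod>t\<in>{1..T}. h t (snd \<omega> t)))"
    by (simp add: of_bool_Q_eq_prod[OF assms] g_def h_def exp_sum mult.commute)
  have measurable_gh: "g t \<in> borel_measurable borel" "h t \<in> borel_measurable borel" for t
    unfolding g_def h_def by measurable
  have integrable_h: "integrable M (\<lambda>\<omega>. h t (snd \<omega> t))" if "t \<in> {1..T}" for t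
    using measurable_compose[OF coin_borel_measurable[OF that] measurable_gh(2)]
    by (intro integrable_const_bound[of _ 1]) (auto simp: h_def)
  have integrable_g: "integrable M (\<lambda>\<omega>. g t (fst \<omega> t))" if "t \<in> {1..T}" for t
    unfolding g_def by (rule integrable_exp_noise[OF that])
  show "integrable M ?f"
    unfolding f_eq_prod by (rule integrable_noise_coin_prod[OF measurable_gh integrable_g integrable_h])
  have "expectation ?f =
      (\<Prod>t\<in>{1..T}. expectation (\<lambda>\<omega>. g t (fst \<omega> t))) * (\<Prod>t\<in>{1..T}. expectation (\<lambda>\<omega>. h t (snd \<omega> t)))"
    unfolding f_eq_prod by (rule expectation_noise_coin_prod[OF measurable_gh integrable_g integrable_h])
  also have "\<dots> = (\<Prod>t\<in>{1..T}. expectation (\<lambda>\<omega>. exp (c t * fst \<omega> t))) * qset_prob T S"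
    unfolding g_def h_def by (simp only: prod_expectation_coins)
  also have "\<dots> \<le> exp (eta\<^sup>2 / 2 * (\<Sum>s\<in>{1..T}. (c s)\<^sup>2)) * qset_prob T S"
    by (intro mult_right_mono prod_expectation_exp_noise_le qset_prob_nonneg)
  finally show "expectation ?f \<le> qset_prob T S * exp (eta\<^sup>2 / 2 * (\<Sum>s\<in>{1..T}. (c s)\<^sup>2))"
    by (simp only: mult.commute)
qed

lemma measurable_Q: "Q \<in> measurable M (count_space (Pow {1..T}))"
proof (subst measurable_count_space_eq2, simp, intro conjI ballI)
  show "Q \<in> space M \<rightarrow> Pow {1..T}" using queried_subset by auto
  fix S assume "S \<in> Pow {1..T}"
  have "Q -` {S} \<inter> space M = {\<omega> \<in> space M. Q \<omega> = S}" by auto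
  also have "\<dots> = {\<omega> \<in> space M. \<forall>t\<in>{1..T}. snd \<omega> t < query_prob (past S t) t \<longleftrightarrow> t \<in> S}"
    using \<open>S \<in> Pow {1..T}\<close> by (simp add: queried_eq_iff)
  also have "\<dots> \<in> sets M"
  proof (rule sets.sets_Collect_finite_All)
    fix t assume "t \<in> {1..T}"
    note [measurable] = coin_borel_measurable[OF this]
    show "{\<omega> \<in> space M. snd \<omega> t < query_prob (past S t) t \<longleftrightarrow> t \<in> S} \<in> sets M" by measurable
  qed simp
  finally show "Q -` {S} \<inter> space M \<in> sets M" .
qed

lemma borel_measurable_Q:
  assumes "\<And>S. S \<subseteq> {1..T} \<Longrightarrow> f S \<in> borel_measurable M"
  shows "(\<lambda>\<omega>. f (Q \<omega>) \<omega> :: real) \<in> borel_measurable M"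
  by (rule measurable_compose_countable'[where f = f, OF assms measurable_Q]) (auto intro: countable_finite)

definition exponent :: "(nat set \<Rightarrow> real) \<Rightarrow> (nat set \<Rightarrow> nat \<Rightarrow> real) \<Rightarrow> omega \<Rightarrow> real" where
  "exponent a c \<omega> = a (Q \<omega>) + (\<Sum>s\<in>{1..T}. c (Q \<omega>) s * fst \<omega> s)"

lemma borel_measurable_exponent [measurable]: "exponent a c \<in> borel_measurable M"
  unfolding exponent_def[abs_def]
  by (rule borel_measurable_Q[where f = "\<lambda>S \<omega>. a S + (\<Sum>s\<in>{1..T}. c S s * fst \<omega> s)"])
    (intro borel_measurable_sum borel_measurable_add borel_measurable_times borel_measurable_const
      noise_borel_measurable)

lemma exp_exponent_eq_sum:
  "exp (exponent a c \<omega>) =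
    (\<Sum>S\<in>Pow {1..T}. exp (a S) * (of_bool (Q \<omega> = S) * exp (\<Sum>s\<in>{1..T}. c S s * fst \<omega> s)))"
proof -
  have "exp (exponent a c \<omega>) = exp (a (Q \<omega>)) * exp (\<Sum>s\<in>{1..T}. c (Q \<omega>) s * fst \<omega> s)"
    unfolding exponent_def by (rule exp_add)
  also have "\<dots> = (\<Sum>S\<in>Pow {1..T}. if Q \<omega> = S then exp (a S) * exp (\<Sum>s\<in>{1..T}. c S s * fst \<omega> s) else 0)"
    using queried_subset[of "snd \<omega>" T] by (simp add: sum.delta')
  finally show ?thesis
    by (simp add: of_bool_def if_distrib[of "\<lambda>r. _ * (r * _)"] cong: if_cong)
qed

lemma integrable_exp_exponent: "integrable M (\<lambda>\<omega>. exp (exponent a c \<omega>))"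
  unfolding exp_exponent_eq_sum
  by (intro Bochner_Integration.integrable_sum integrable_mult_right integrable_exp_noise_on_Q) simp

lemma expectation_exp_exponent_le:
  "expectation (\<lambda>\<omega>. exp (exponent a c \<omega>))
    \<le> (\<Sum>S\<in>Pow {1..T}. qset_prob T S * exp (a S + eta\<^sup>2 / 2 * (\<Sum>s\<in>{1..T}. (c S s)\<^sup>2)))"
proof -
  have "expectation (\<lambda>\<omega>. exp (exponent a c \<omega>)) = (\<Sum>S\<in>Pow {1..T}.
      exp (a S) * expectation (\<lambda>\<omega>. of_bool (Q \<omega> = S) * exp (\<Sum>s\<in>{1..T}. c S s * fst \<omega> s)))"
    unfolding exp_exponent_eq_sum using integrable_exp_noise_on_Q
    by (subst Bochner_Integration.integral_sum) auto
  also have "\<dots> \<le> (\<Sum>S\<in>Pow {1..T}.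
      exp (a S) * (qset_prob T S * exp (eta\<^sup>2 / 2 * (\<Sum>s\<in>{1..T}. (c S s)\<^sup>2))))"
    by (intro sum_mono mult_left_mono expectation_exp_noise_on_Q_le) auto
  finally show ?thesis by (simp add: exp_add mult_ac)
qed

lemma prob_exponent_gt_le:
  assumes "(\<Sum>S\<in>Pow {1..T}. qset_prob T S * exp (a S + eta\<^sup>2 / 2 * (\<Sum>s\<in>{1..T}. (c S s)\<^sup>2))) \<le> 1"
  shows "prob {\<omega> \<in> space M. b < exponent a c \<omega>} \<le> exp (- b)"
proof -
  have "prob {\<omega> \<in> space M. b < exponent a c \<omega>} \<le> prob {\<omega> \<in> space M. exp b \<le> exp (exponent a c \<omega>)}"
    by (intro finite_measure_mono) auto
  also have "\<dots> \<le> expectation (\<lambda>\<omega>. exp (exponent a c \<omega>)) / exp b"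
    by (intro integral_Markov_inequality_measure[of _ _ "{}"] integrable_exp_exponent) auto
  also have "\<dots> \<le> exp (- b)"
    using order_trans[OF expectation_exp_exponent_le assms]
    by (simp add: exp_minus inverse_eq_divide divide_right_mono)
  finally show ?thesis .
qed

lemma prob_supermartingale_gt_le:
  assumes "supermartingale_increment g"
  shows "prob {\<omega> \<in> space M. b < (\<Sum>t\<in>{1..T}. g t (history \<omega> t) (t \<in> Q \<omega>))} \<le> exp (- b)"
  using prob_exponent_gt_le[of "\<lambda>S. \<Sum>t\<in>{1..T}. g t (past S t) (t \<in> S)" "\<lambda>_ _. 0" b]
    sum_qset_prob_exp_le_1[OF assms, of T] by (simp add: exponent_def)

definition many_queries :: "real \<Rightarrow> omega set" where
  "many_queries b =
    {\<omega> \<in> space M. 2 * (\<Sum>t\<in>{1..T}. query_prob (history \<omega> t) t) + b < card (Q \<omega>)}"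

definition undersampled :: "nat set \<Rightarrow> real \<Rightarrow> omega set" where
  "undersampled A b =
    {\<omega> \<in> space M. 2 * (\<Sum>t\<in>A \<inter> Q \<omega>. uncertainty (history \<omega> t) t) + 2 * b
      < (\<Sum>t\<in>A. query_prob (history \<omega> t) t * uncertainty (history \<omega> t) t)}"

definition noisy :: "nat \<Rightarrow> real \<Rightarrow> real \<Rightarrow> omega set" where
  "noisy t \<sigma> b =
    {\<omega> \<in> space M. b < exponent (\<lambda>_. - 1 / 2) (\<lambda>S s. \<sigma> * normalized_weight (past S t) t s) \<omega>}"

lemma sets_Collect_Q: "{\<omega> \<in> space M. P (Q \<omega>)} \<in> events"
proof -
  have "{\<omega> \<in> space M. P (Q \<omega>)} = Q -` {S \<in> Pow {1..T}. P S} \<inter> space M"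
    using queried_subset by auto
  also have "\<dots> \<in> events"
    by (rule measurable_sets[OF measurable_Q]) auto
  finally show ?thesis .
qed

lemma sets_many_queries: "many_queries b \<in> events"
  and sets_undersampled: "undersampled A b \<in> events"
  unfolding many_queries_def undersampled_def by (rule sets_Collect_Q)+

lemma sets_noisy: "noisy t \<sigma> b \<in> events"
  unfolding noisy_def by measurable

lemma prob_many_queries_le: "prob (many_queries b) \<le> exp (- b)"
proof -
  have "(\<Sum>t\<in>{1..T}. of_bool (t \<in> Q \<omega>) :: real) = card (Q \<omega>)" for \<omega>
    using queried_subset[of "snd \<omega>" T] by (simp add: Int_absorb1 of_bool_def flip: sum.inter_restrict)
  then show ?thesis
    using prob_supermartingale_gt_le[OF supermartingale_increment_query, of b]
    by (simp add: many_queries_def sum_subtractf sum_distrib_left less_diff_eq add.commute)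
qed

lemma prob_undersampled_le:
  assumes "A \<subseteq> {1..T}"
  shows "prob (undersampled A b) \<le> exp (- b)"
proof -
  define u where "u \<omega> t = uncertainty (history \<omega> t) t" for \<omega> t
  define p where "p \<omega> t = query_prob (history \<omega> t) t" for \<omega> t
  have "finite A" using assms finite_subset by blast
  have increments: "(\<Sum>t\<in>{1..T}. of_bool (t \<in> A) * (p \<omega> t * u \<omega> t / 2 - of_bool (t \<in> Q \<omega>) * u \<omega> t))
      = (\<Sum>t\<in>A. p \<omega> t * u \<omega> t) / 2 - (\<Sum>t\<in>A \<inter> Q \<omega>. u \<omega> t)" (is "?l = _") for \<omega>
  proof -
    have "?l = (\<Sum>t\<in>A. p \<omega> t * u \<omega> t / 2 - of_bool (t \<in> Q \<omega>) * u \<omega> t)"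
      using assms by (intro sum.mono_neutral_cong_right) auto
    moreover have "(\<Sum>t\<in>A. of_bool (t \<in> Q \<omega>) * u \<omega> t) = (\<Sum>t\<in>A \<inter> Q \<omega>. u \<omega> t)"
      unfolding sum.inter_restrict[OF \<open>finite A\<close>] by (intro sum.cong) auto
    ultimately show ?thesis by (simp add: sum_subtractf sum_divide_distrib)
  qed
  have rearrange: "2 * v + 2 * b < w \<longleftrightarrow> b < w / 2 - v" for v w :: real by auto
  show ?thesis
    using prob_supermartingale_gt_le[OF supermartingale_increment_uncertainty, of b A]
    unfolding undersampled_def rearrange u_def[symmetric] p_def[symmetric] increments .
qed

lemma prob_noisy_le:
  assumes "\<sigma>\<^sup>2 = 1"
  shows "prob (noisy t \<sigma> b) \<le> exp (- b)"
proof -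
  let ?c = "\<lambda>S s. \<sigma> * normalized_weight (past S t) t s"
  have "(\<Sum>S\<in>Pow {1..T}. qset_prob T S * exp (- 1 / 2 + eta\<^sup>2 / 2 * (\<Sum>s\<in>{1..T}. (?c S s)\<^sup>2)))
      \<le> (\<Sum>S\<in>Pow {1..T}. qset_prob T S)"
  proof (intro sum_mono mult_left_le qset_prob_nonneg)
    fix S assume S_subset: "S \<in> Pow {1..T}"
    have "eta\<^sup>2 * (\<Sum>s\<in>{1..T}. (normalized_weight (past S t) t s)\<^sup>2) \<le> 1"
      using S_subset eta_nonneg by (intro sum_normalized_weight_squares_le) auto
    then show "exp (- 1 / 2 + eta\<^sup>2 / 2 * (\<Sum>s\<in>{1..T}. (?c S s)\<^sup>2)) \<le> 1"
      by (simp add: power_mult_distrib assms)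
  qed
  also have "\<dots> \<le> 1" by (rule sum_qset_prob_le_1)
  finally show ?thesis
    unfolding noisy_def by (rule prob_exponent_gt_le)
qed

lemma estimate_noise_le:
  assumes "\<omega> \<in> space M" "\<omega> \<notin> noisy t 1 b" "\<omega> \<notin> noisy t (- 1) b"
  shows "\<bar>estimate (history \<omega> t) (fst \<omega>) t\<bar>
    \<le> (b + 1 / 2) * (etat eta * sqrt (leverage (history \<omega> t) t))"
proof -
  define N where "N = (\<Sum>s\<in>{1..T}. normalized_weight (history \<omega> t) t s * fst \<omega> s)"
  define r where "r = etat eta * sqrt (leverage (history \<omega> t) t)"
  have "\<bar>N\<bar> \<le> b + 1 / 2"
    using assms by (auto simp: noisy_def exponent_def N_def abs_le_iff sum_negf)
  moreover have "0 \<le> r"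
    using etat_ge_1[of eta] by (simp add: r_def leverage_nonneg)
  moreover have "estimate (history \<omega> t) (fst \<omega>) t = N * r"
    using queried_subset unfolding N_def r_def by (intro estimate_eq_normalized) auto
  ultimately show ?thesis
    by (simp add: abs_mult mult_right_mono flip: r_def)
qed

lemma borel_measurable_regret:
  "(\<lambda>\<omega>. regret d C eta alpha x (snd \<omega>) (\<lambda>t. ip d theta (x t) + fst \<omega> t) theta T) \<in> borel_measurable M"
  unfolding regret_eq estimate_def clip_def
  by (rule borel_measurable_Q[where f = "\<lambda>S \<omega>. \<Sum>t=1..T. (min 1 (max (- 1)
        (\<Sum>s\<in>past S t. weight (past S t) t s * (ip d theta (x s) + fst \<omega> s))) - ip d theta (x t))\<^sup>2"])
    (intro borel_measurable_sum borel_measurable_power borel_measurable_diff borel_measurable_min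
      borel_measurable_max borel_measurable_times borel_measurable_add borel_measurable_const
      noise_borel_measurable, auto)

end

section \<open>Query and regret bounds for a partition into subspaces\<close>

definition log_factor :: "nat \<Rightarrow> real \<Rightarrow> real \<Rightarrow> real" where
  "log_factor T \<delta> C = ln (exp 1 + real T) + ln (exp 1 + 1 / \<delta>) + ln (exp 1 + C)"

lemma ln_exp_1_add_ge_1: "0 \<le> a \<Longrightarrow> 1 \<le> ln (exp 1 + a :: real)"
  by (simp add: ln_ge_iff add_pos_nonneg)

lemma ln_confidence_le:
  assumes "T \<ge> 1" "\<delta> > 0" "C > 0"
  shows "ln (4 * real T / \<delta>) + 1 / 2 \<le> 3 * log_factor T \<delta> C"
proof -
  have "ln (4 * real T / \<delta>) = 2 * ln 2 + ln (real T) + ln (1 / \<delta>)"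
    using assms ln_realpow[of 2 2] by (simp add: ln_mult ln_div)
  moreover have "ln (real T) \<le> ln (exp 1 + real T)" "ln (1 / \<delta>) \<le> ln (exp 1 + 1 / \<delta>)"
    using assms by (auto intro!: ln_mono)
  moreover have "1 \<le> ln (exp 1 + real T)" "1 \<le> ln (exp 1 + 1 / \<delta>)" "1 \<le> ln (exp 1 + C)"
    using assms by (simp_all add: ln_exp_1_add_ge_1)
  ultimately show ?thesis
    using ln_2_less_1 unfolding log_factor_def by argo
qed

lemma ln_potential_le:
  assumes "\<delta> > 0" "C > 0"
  shows "ln (1 + C\<^sup>2 * T) + 1 \<le> 3 * log_factor T \<delta> C"
proof -
  have "1 + C\<^sup>2 * T \<le> (exp 1 + C)\<^sup>2 * exp 1 + (exp 1 + C)\<^sup>2 * T"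
  proof (intro add_mono mult_right_mono)
    have "1 * 1 \<le> (exp 1 + C)\<^sup>2 * exp 1"
      using assms by (intro mult_mono one_le_power) (auto intro: add_increasing2)
    then show "1 \<le> (exp 1 + C)\<^sup>2 * exp 1" by simp
  qed (use assms in \<open>auto intro!: power_mono\<close>)
  also have "\<dots> = (exp 1 + C)\<^sup>2 * (exp 1 + T)" by (simp add: distrib_left)
  finally have "ln (1 + C\<^sup>2 * T) \<le> ln ((exp 1 + C)\<^sup>2 * (exp 1 + T))"
    by (intro ln_mono) (auto intro: add_pos_nonneg)
  also have "\<dots> = 2 * ln (exp 1 + C) + ln (exp 1 + T)"
  proof -
    have "exp 1 + C > 0" "exp 1 + real T > 0" using assms by (simp_all add: add_pos_nonneg)
    then show ?thesis by (simp add: ln_mult ln_realpow)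
  qed
  finally show ?thesis
    using assms ln_exp_1_add_ge_1[of T] ln_exp_1_add_ge_1[of "1 / \<delta>"] ln_exp_1_add_ge_1[of C]
    unfolding log_factor_def by simp
qed

text \<open>\<open>\<Lambda>\<close> bounds all logarithms that occur in the analysis.\<close>
locale qufur_partition = qufur +
  fixes T :: nat and theta :: "nat \<Rightarrow> real" and m :: nat and I :: "nat \<Rightarrow> nat set" and du :: "nat \<Rightarrow> nat"
    and \<Lambda> :: real
  assumes T_ge_1: "T \<ge> 1"
    and theta_norm: "sqrt (ip d theta theta) \<le> C"
    and x_norm: "\<And>t. t \<in> {1..T} \<Longrightarrow> sqrt (ip d (x t) (x t)) \<le> 1"
    and theta_x: "\<And>t. t \<in> {1..T} \<Longrightarrow> \<bar>ip d theta (x t)\<bar> \<le> 1"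
    and I_nonempty: "\<And>u. u \<in> {1..m} \<Longrightarrow> I u \<noteq> {}"
    and I_disjoint: "\<And>u v. u \<in> {1..m} \<Longrightarrow> v \<in> {1..m} \<Longrightarrow> u \<noteq> v \<Longrightarrow> I u \<inter> I v = {}"
    and I_cover: "(\<Union>u\<in>{1..m}. I u) = {1..T}"
    and I_subspace: "\<And>u. u \<in> {1..m} \<Longrightarrow> in_subspace_dim d (du u) (x ` I u)"
    and ln_potential_le_\<Lambda>: "ln (1 + C\<^sup>2 * T) + 1 \<le> \<Lambda>"
begin

definition query_budget :: "nat \<Rightarrow> real" where
  "query_budget u = min (real (card (I u))) (etat eta * sqrt (alpha * real (du u) * real (card (I u))))"

definition regret_budget :: "nat \<Rightarrow> real" where
  "regret_budget u = max ((etat eta)\<^sup>2 * real (du u)) (etat eta * sqrt (real (du u) * real (card (I u)) / alpha))"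

lemma query_budget_nonneg: "0 \<le> query_budget u"
  using etat_ge_1[of eta] alpha_pos by (simp add: query_budget_def)

lemma regret_budget_nonneg: "0 \<le> regret_budget u"
  by (simp add: regret_budget_def max.coboundedI1)

lemma \<Lambda>_ge_1: "1 \<le> \<Lambda>"
proof -
  have "0 \<le> ln (1 + C\<^sup>2 * T)" by (rule ln_ge_zero) simp
  then show ?thesis using ln_potential_le_\<Lambda> by linarith
qed

lemma I_subset: "u \<in> {1..m} \<Longrightarrow> I u \<subseteq> {1..T}"
  using I_cover by blast

lemma finite_I: "u \<in> {1..m} \<Longrightarrow> finite (I u)"
  using I_subset finite_subset by blast

lemma sum_partition: "(\<Sum>t\<in>{1..T}. f t) = (\<Sum>u=1..m. \<Sum>t\<in>I u. f t)" for f :: "nat \<Rightarrow> real"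
  unfolding I_cover[symmetric] using finite_I I_disjoint by (intro sum.UNION_disjoint) auto

lemma m_le_T: "m \<le> T"
proof -
  have "m = (\<Sum>u=1..m. 1)" by simp
  also have "\<dots> \<le> (\<Sum>u=1..m. card (I u))"
    using finite_I I_nonempty by (intro sum_mono) (simp add: Suc_leI card_gt_0_iff)
  also have "\<dots> = card (\<Union>u\<in>{1..m}. I u)"
    using finite_I I_disjoint by (intro card_UN_disjoint[symmetric]) auto
  also have "\<dots> = T" unfolding I_cover by simp
  finally show ?thesis .
qed

lemma uncertainty_eq_0:
  assumes "u \<in> {1..m}" "du u = 0" "t \<in> I u"
  shows "uncertainty R t = 0"
proof -
  have "\<forall>i<d. x t i = 0"
    using I_subspace[OF assms(1)] assms(2,3) by (auto simp: in_subspace_dim_def)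
  then show ?thesis by (simp add: uncertainty_def leverage_def inv_ip_def ip_def)
qed

definition well_sampled :: "nat set \<Rightarrow> nat \<Rightarrow> bool" where
  "well_sampled S u \<longleftrightarrow>
    (\<Sum>t\<in>I u. query_prob (past S t) t * Delta (past S t) t) \<le> 6 * (etat eta)\<^sup>2 * du u * \<Lambda>"

lemma well_sampledI:
  assumes u_in: "u \<in> {1..m}" and b_le: "b \<le> \<Lambda>"
    and sampled: "(\<Sum>t\<in>I u. query_prob (past S t) t * uncertainty (past S t) t)
      \<le> 2 * (\<Sum>t\<in>I u \<inter> S. uncertainty (past S t) t) + 2 * b"
  shows "well_sampled S u"
proof (cases "du u = 0")
  case True
  then show ?thesis by (simp add: well_sampled_def Delta_eq uncertainty_eq_0[OF u_in])
next
  case False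
  have "(\<Sum>t\<in>I u \<inter> S. uncertainty (past S t) t) \<le> 2 * (du u * ln (1 + C\<^sup>2 * T) + 1)"
    using I_subset[OF u_in] x_norm T_ge_1 card_mono[OF _ I_subset[OF u_in]]
    by (intro sum_uncertainty_subspace_le I_subspace u_in finite_I) auto
  also have "du u * ln (1 + C\<^sup>2 * T) + 1 \<le> du u * (ln (1 + C\<^sup>2 * T) + 1)"
    using False by (simp add: distrib_left)
  also have "\<dots> \<le> du u * \<Lambda>"
    by (intro mult_left_mono ln_potential_le_\<Lambda>) simp
  moreover have "\<Lambda> \<le> du u * \<Lambda>"
    using False \<Lambda>_ge_1 by (simp add: mult_le_cancel_right1)
  ultimately have "(\<Sum>t\<in>I u. query_prob (past S t) t * uncertainty (past S t) t) \<le> 6 * (du u * \<Lambda>)"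
    using sampled b_le by linarith
  then have "(etat eta)\<^sup>2 * (\<Sum>t\<in>I u. query_prob (past S t) t * uncertainty (past S t) t)
      \<le> (etat eta)\<^sup>2 * (6 * (du u * \<Lambda>))"
    by (intro mult_left_mono) auto
  then show ?thesis by (simp add: well_sampled_def Delta_eq sum_distrib_left mult_ac)
qed

lemma sqrt_6_\<Lambda>_le: "sqrt (6 * \<Lambda>) \<le> 3 * \<Lambda>"
  using \<Lambda>_ge_1 by (intro real_le_lsqrt) (auto simp: power2_eq_square)

lemma sum_query_prob_le:
  assumes "well_sampled S u"
  shows "(\<Sum>t\<in>I u. query_prob (past S t) t) \<le> 3 * \<Lambda> * query_budget u"
proof -
  let ?n = "card (I u)"
  have "(\<Sum>t\<in>I u. query_prob (past S t) t) \<le> sqrt (?n * (alpha * (6 * (etat eta)\<^sup>2 * du u * \<Lambda>)))"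
    unfolding query_prob_def using assms alpha_pos Delta_nonneg
    by (intro sum_min_1_le_sqrt) (auto simp: query_prob_def well_sampled_def)
  also have "?n * (alpha * (6 * (etat eta)\<^sup>2 * du u * \<Lambda>)) = 6 * \<Lambda> * ((etat eta)\<^sup>2 * (alpha * du u * ?n))"
    by simp
  also have "sqrt \<dots> = sqrt (6 * \<Lambda>) * (etat eta * sqrt (alpha * du u * ?n))"
    using etat_ge_1[of eta] by (simp only: real_sqrt_mult real_sqrt_abs abs_of_nonneg)
  also have "\<dots> \<le> 3 * \<Lambda> * (etat eta * sqrt (alpha * du u * ?n))"
    using etat_ge_1[of eta] alpha_pos by (intro mult_right_mono sqrt_6_\<Lambda>_le) simp
  finally have "(\<Sum>t\<in>I u. query_prob (past S t) t) \<le> 3 * \<Lambda> * (etat eta * sqrt (alpha * du u * ?n))" .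
  moreover have "(\<Sum>t\<in>I u. query_prob (past S t) t) \<le> 3 * \<Lambda> * ?n"
  proof -
    have "(\<Sum>t\<in>I u. query_prob (past S t) t) \<le> ?n"
      using sum_bounded_above[of "I u" "\<lambda>t. query_prob (past S t) t" 1] query_prob_bounds by simp
    also have "\<dots> \<le> 3 * \<Lambda> * ?n"
      using \<Lambda>_ge_1 by (simp add: mult_le_cancel_right1)
    finally show ?thesis .
  qed
  ultimately show ?thesis by (simp add: query_budget_def min_def)
qed

lemma sum_Delta_le:
  assumes "well_sampled S u"
  shows "(\<Sum>t\<in>I u. Delta (past S t) t) \<le> 9 * \<Lambda> * regret_budget u"
proof -
  let ?n = "card (I u)"
  have "(\<Sum>t\<in>I u. Delta (past S t) t)
      \<le> 6 * (etat eta)\<^sup>2 * du u * \<Lambda> + sqrt (?n * (6 * (etat eta)\<^sup>2 * du u * \<Lambda> / alpha))"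
    using assms alpha_pos Delta_nonneg by (intro sum_le_add_sqrt) (auto simp: query_prob_def well_sampled_def)
  also have "?n * (6 * (etat eta)\<^sup>2 * du u * \<Lambda> / alpha) = 6 * \<Lambda> * ((etat eta)\<^sup>2 * (du u * ?n / alpha))"
    by simp
  also have "sqrt \<dots> = sqrt (6 * \<Lambda>) * (etat eta * sqrt (du u * ?n / alpha))"
    using etat_ge_1[of eta] by (simp only: real_sqrt_mult real_sqrt_abs abs_of_nonneg)
  also have "\<dots> \<le> 3 * \<Lambda> * (etat eta * sqrt (du u * ?n / alpha))"
    using etat_ge_1[of eta] alpha_pos by (intro mult_right_mono sqrt_6_\<Lambda>_le) simp
  also have "\<dots> \<le> 3 * \<Lambda> * regret_budget u"
    using \<Lambda>_ge_1 by (intro mult_left_mono) (simp_all add: regret_budget_def)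
  also have "6 * (etat eta)\<^sup>2 * du u * \<Lambda> = 6 * \<Lambda> * ((etat eta)\<^sup>2 * du u)" by simp
  also have "\<dots> \<le> 6 * \<Lambda> * regret_budget u"
    using \<Lambda>_ge_1 by (intro mult_left_mono) (simp_all add: regret_budget_def)
  finally show ?thesis by simp
qed

lemma card_queried_le:
  assumes "b \<le> \<Lambda>" "\<And>u. u \<in> {1..m} \<Longrightarrow> well_sampled S u"
    and "card S \<le> 2 * (\<Sum>t\<in>{1..T}. query_prob (past S t) t) + b"
  shows "card S \<le> 6 * \<Lambda> * ((\<Sum>u=1..m. query_budget u) + 1)"
proof -
  have "(\<Sum>t\<in>{1..T}. query_prob (past S t) t) \<le> (\<Sum>u=1..m. 3 * \<Lambda> * query_budget u)"
    unfolding sum_partition using assms(2) by (intro sum_mono sum_query_prob_le) auto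
  then show ?thesis
    using assms(1,3) \<Lambda>_ge_1 by (simp add: distrib_left flip: sum_distrib_left)
qed

lemma sum_squared_error_le:
  assumes "\<And>u. u \<in> {1..m} \<Longrightarrow> well_sampled S u"
    and "\<And>t. t \<in> {1..T} \<Longrightarrow>
      \<bar>estimate (past S t) \<xi> t\<bar> \<le> \<Lambda> * (etat eta * sqrt (leverage (past S t) t))"
  shows "(\<Sum>t=1..T. (clip (estimate (past S t) (\<lambda>s. ip d theta (x s) + \<xi> s) t) - ip d theta (x t))\<^sup>2)
    \<le> 36 * \<Lambda> ^ 3 * (\<Sum>u=1..m. regret_budget u)"
    (is "?l \<le> _")
proof -
  have "?l \<le> (\<Sum>t\<in>{1..T}. 4 * \<Lambda>\<^sup>2 * Delta (past S t) t)"
    using assms(2) by (intro sum_mono prediction_error_le theta_norm theta_x \<Lambda>_ge_1) auto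
  also have "\<dots> = 4 * \<Lambda>\<^sup>2 * (\<Sum>u=1..m. \<Sum>t\<in>I u. Delta (past S t) t)"
    unfolding sum_partition by (simp only: sum_distrib_left)
  also have "\<dots> \<le> 4 * \<Lambda>\<^sup>2 * (\<Sum>u=1..m. 9 * \<Lambda> * regret_budget u)"
    using assms(1) by (intro mult_left_mono sum_mono sum_Delta_le) auto
  finally show ?thesis
    by (simp add: power2_eq_square power3_eq_cube flip: sum_distrib_left)
qed

end

locale qufur_run =
  qufur_noise d C eta alpha x T M + qufur_partition d C eta alpha x T theta m I du \<Lambda>
  for d C eta alpha x T M theta m I du \<Lambda> +
  fixes \<delta> :: real
  assumes \<delta>_pos: "\<delta> > 0" and ln_confidence_le_\<Lambda>: "ln (4 * real T / \<delta>) + 1 / 2 \<le> \<Lambda>"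
begin

definition bad_event :: "real \<Rightarrow> omega set" where
  "bad_event b = many_queries b \<union> (\<Union>u\<in>{1..m}. undersampled (I u) b)
    \<union> (\<Union>t\<in>{1..T}. noisy t 1 b \<union> noisy t (- 1) b)"

lemma sets_bad_event: "bad_event b \<in> events"
  unfolding bad_event_def
  by (intro sets.Un sets.finite_UN sets_many_queries sets_undersampled sets_noisy) auto

lemma prob_bad_event_le: "prob (bad_event b) \<le> 4 * T * exp (- b)"
proof -
  let ?U = "\<Union>u\<in>{1..m}. undersampled (I u) b" and ?N = "\<Union>t\<in>{1..T}. noisy t 1 b \<union> noisy t (- 1) b"
  have "prob ?U \<le> (\<Sum>u\<in>{1..m}. prob (undersampled (I u) b))"
    by (intro measure_UNION_le sets_undersampled) simp
  also have "\<dots> \<le> (\<Sum>u\<in>{1..m}. exp (- b))"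
    by (intro sum_mono prob_undersampled_le I_subset)
  finally have prob_undersampled: "prob ?U \<le> m * exp (- b)" by simp
  have "prob ?N \<le> (\<Sum>t\<in>{1..T}. prob (noisy t 1 b \<union> noisy t (- 1) b))"
    by (intro measure_UNION_le sets.Un sets_noisy) simp
  also have "\<dots> \<le> (\<Sum>t\<in>{1..T}. exp (- b) + exp (- b))"
    by (intro sum_mono order_trans[OF measure_Un_le] add_mono sets_noisy prob_noisy_le) simp_all
  finally have prob_noisy: "prob ?N \<le> 2 * T * exp (- b)" by simp
  have "prob (bad_event b) \<le> prob (many_queries b) + prob ?U + prob ?N"
    unfolding bad_event_def
    by (intro order_trans[OF measure_Un_le] add_mono order_refl sets.Un sets.finite_UN
        sets_many_queries sets_undersampled sets_noisy) auto
  also have "\<dots> \<le> (1 + m + 2 * T) * exp (- b)"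
    using prob_many_queries_le[of b] prob_undersampled prob_noisy by (simp add: distrib_right)
  also have "\<dots> \<le> 4 * T * exp (- b)"
    using m_le_T T_ge_1 by (intro mult_right_mono) simp_all
  finally show ?thesis .
qed

lemma
  assumes "\<omega> \<in> space M" "\<omega> \<notin> bad_event b" "b + 1 / 2 \<le> \<Lambda>"
  shows query_complexity_le_if_not_bad:
      "query_complexity d C eta alpha x (snd \<omega>) T \<le> 6 * \<Lambda> * ((\<Sum>u=1..m. query_budget u) + 1)"
    and regret_le_if_not_bad:
      "regret d C eta alpha x (snd \<omega>) (\<lambda>t. ip d theta (x t) + fst \<omega> t) theta T
        \<le> 36 * \<Lambda> ^ 3 * (\<Sum>u=1..m. regret_budget u)"
proof -
  have sampled: "well_sampled (Q \<omega>) u" if u_in: "u \<in> {1..m}" for u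
  proof (rule well_sampledI[OF u_in])
    show "b \<le> \<Lambda>" using assms(3) by simp
    have "\<omega> \<notin> undersampled (I u) b"
      using assms(2) u_in by (auto simp: bad_event_def)
    then show "(\<Sum>t\<in>I u. query_prob (history \<omega> t) t * uncertainty (history \<omega> t) t)
        \<le> 2 * (\<Sum>t\<in>I u \<inter> Q \<omega>. uncertainty (history \<omega> t) t) + 2 * b"
      using assms(1) by (simp add: undersampled_def not_less)
  qed
  have noise: "\<bar>estimate (history \<omega> t) (fst \<omega>) t\<bar> \<le> \<Lambda> * (etat eta * sqrt (leverage (history \<omega> t) t))"
    if "t \<in> {1..T}" for t
  proof -
    have "\<bar>estimate (history \<omega> t) (fst \<omega>) t\<bar> \<le> (b + 1 / 2) * (etat eta * sqrt (leverage (history \<omega> t) t))"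
      using assms(1,2) that by (intro estimate_noise_le) (auto simp: bad_event_def)
    also have "\<dots> \<le> \<Lambda> * (etat eta * sqrt (leverage (history \<omega> t) t))"
      using assms(3) etat_ge_1[of eta] by (intro mult_right_mono) (simp_all add: leverage_nonneg)
    finally show ?thesis .
  qed
  show "query_complexity d C eta alpha x (snd \<omega>) T \<le> 6 * \<Lambda> * ((\<Sum>u=1..m. query_budget u) + 1)"
    unfolding query_complexity_def using assms
    by (intro card_queried_le[OF _ sampled, of b])
      (auto simp: bad_event_def many_queries_def)
  show "regret d C eta alpha x (snd \<omega>) (\<lambda>t. ip d theta (x t) + fst \<omega> t) theta T
      \<le> 36 * \<Lambda> ^ 3 * (\<Sum>u=1..m. regret_budget u)"
    unfolding regret_eq by (intro sum_squared_error_le sampled noise)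
qed

lemma prob_query_regret_le:
  assumes "6 * \<Lambda> \<le> B" "36 * \<Lambda> ^ 3 \<le> B"
  shows "1 - \<delta> \<le> prob {\<omega> \<in> space M.
    real (query_complexity d C eta alpha x (snd \<omega>) T) \<le> B * ((\<Sum>u=1..m. query_budget u) + 1) \<and>
    regret d C eta alpha x (snd \<omega>) (\<lambda>t. ip d theta (x t) + fst \<omega> t) theta T
      \<le> B * (\<Sum>u=1..m. regret_budget u)}" (is "_ \<le> prob ?good")
proof -
  define b where "b = ln (4 * real T / \<delta>)"
  have "prob (bad_event b) \<le> 4 * T * exp (- b)" by (rule prob_bad_event_le)
  also have "\<dots> = \<delta>" using T_ge_1 \<delta>_pos by (simp add: b_def exp_minus)
  finally have "1 - \<delta> \<le> prob (space M - bad_event b)"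
    by (simp add: prob_compl sets_bad_event)
  also have "\<dots> \<le> prob ?good"
  proof (rule finite_measure_mono)
    note [measurable] = borel_measurable_regret[of theta]
    show "?good \<in> events"
      unfolding query_complexity_def by (intro sets.sets_Collect_conj sets_Collect_Q) measurable
    have budgets: "0 \<le> (\<Sum>u=1..m. query_budget u) + 1" "0 \<le> (\<Sum>u=1..m. regret_budget u)"
      by (simp_all add: sum_nonneg query_budget_nonneg regret_budget_nonneg add_nonneg_nonneg)
    show "space M - bad_event b \<subseteq> ?good"
      using query_complexity_le_if_not_bad regret_le_if_not_bad ln_confidence_le_\<Lambda>
        mult_right_mono[OF assms(1) budgets(1)] mult_right_mono[OF assms(2) budgets(2)]
      by (fastforce simp: b_def intro: order_trans)
  qed
  finally show ?thesis .
qed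

end

lemma log_powers_le_powr:
  assumes "(L::real) \<ge> 1"
  shows "6 * (3 * L) \<le> 972 * L powr 972" "36 * (3 * L) ^ 3 \<le> 972 * L powr 972"
proof -
  have "L \<le> L ^ 972" "L ^ 3 \<le> L ^ 972"
    using power_increasing[of 1 972 L] power_increasing[of 3 972 L] assms by simp_all
  then show "6 * (3 * L) \<le> 972 * L powr 972" "36 * (3 * L) ^ 3 \<le> 972 * L powr 972"
    using assms by (simp_all add: power_mult_distrib powr_numeral)
qed

theorem theorem1:
  "\<exists>K::real. K > 0 \<and>
   (\<forall>(d::nat) (T::nat) (C::real) (eta::real) (\<delta>::real) (alpha::real)
      (theta::nat \<Rightarrow> real) (x::nat \<Rightarrow> nat \<Rightarrow> real)
      (m::nat) (I::nat \<Rightarrow> nat set) (du::nat \<Rightarrow> nat) (M::omega measure).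
      d \<ge> 1 \<and> T \<ge> 1 \<and> C > 0 \<and> eta \<ge> 0 \<and> 0 < \<delta> \<and> \<delta> < 1 \<and> alpha > 0 \<and>
      sqrt (ip d theta theta) \<le> C \<and>
      (\<forall>t\<in>{1..T}. sqrt (ip d (x t) (x t)) \<le> 1 \<and> \<bar>ip d theta (x t)\<bar> \<le> 1) \<and>
      (\<forall>u\<in>{1..m}. I u \<noteq> {}) \<and>
      (\<forall>u\<in>{1..m}. \<forall>v\<in>{1..m}. u \<noteq> v \<longrightarrow> I u \<inter> I v = {}) \<and>
      (\<Union>u\<in>{1..m}. I u) = {1..T} \<and>
      (\<forall>u\<in>{1..m}. in_subspace_dim d (du u) (x ` I u)) \<and>
      noise_model M eta T
      \<longrightarrow>
      measure M {\<omega> \<in> space M.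
         (let U = snd \<omega>;
              y = (\<lambda>t. ip d theta (x t) + fst \<omega> t);
              L = ln (exp 1 + real T) + ln (exp 1 + 1 / \<delta>) + ln (exp 1 + C)
          in real (query_complexity d C eta alpha x U T)
               \<le> K * L powr K *
                 ((\<Sum>u=1..m. min (real (card (I u)))
                     (etat eta * sqrt (alpha * real (du u) * real (card (I u))))) + 1)
             \<and> regret d C eta alpha x U y theta T
               \<le> K * L powr K *
                 (\<Sum>u=1..m. max ((etat eta)^2 * real (du u))
                     (etat eta * sqrt (real (du u) * real (card (I u)) / alpha))))}
      \<ge> 1 - \<delta>)"
proof (rule exI[of _ 972], intro conjI allI impI, goal_cases)
  case (2 d T C eta \<delta> alpha theta x m I du M)
  let ?L = "log_factor T \<delta> C"
  interpret qufur_run d C eta alpha x T M theta m I du "3 * ?L" \<delta>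
    using 2 by unfold_locales (auto simp: ln_confidence_le ln_potential_le)
  have "1 \<le> ?L"
    using 2 ln_exp_1_add_ge_1[of T] ln_exp_1_add_ge_1[of "1 / \<delta>"] ln_exp_1_add_ge_1[of C]
    by (simp add: log_factor_def)
  from prob_query_regret_le[OF log_powers_le_powr[OF this]] show ?case
    by (simp only: Let_def log_factor_def query_budget_def regret_budget_def)
qed simp

end
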